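(* Let $\rho$ be a two-qubit density matrix in the set $\mathcal{S}$, i.e. $$\rho=\tfrac12\big(|ab\rangle\langle ab|+e^{-\imath\alpha}R^{\dagger}|ab\rangle\langle a'b'|+e^{\imath\alpha}R\,|a'b'\rangle\langle ab|+|a'b'\rangle\langle a'b'|\big),$$ where $\{|a\rangle,|a'\rangle\}$ and $\{|b\rangle,|b'\rangle\}$ are orthonormal bases of $\mathbb{C}^2$, $\alpha\in[0,2\pi)$, and $R\in\mathbb{C}$ with $|R|\in[0,1]$. Put $F=\frac12(1+|R|)$. Then the optimal value $F^*(\rho)=\max_{\mathcal{D}}F_{\mathcal{D}}(\rho)$ of the fidelity of the kept qubit pair over all LOCC distillation operations $\mathcal{D}$ acting on two copies of $\rho$ is $$F^*(\rho)=\frac{F^2}{F^2+(1-F)^2}.$$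
   Context: Notation: $\dagger$ denotes Hermitian transpose (complex conjugation for scalars), $\imath$ is the imaginary unit, $\{|0\rangle,|1\rangle\}$ is the computational basis of $\mathbb{C}^2$, $|\Phi^+\rangle=\frac1{\sqrt2}(|00\rangle+|11\rangle)$, and $|xy\rangle=|x\rangle\otimes|y\rangle$ with the first factor held by node Alice and the second by node Bob. One round of distillation: Alice and Bob hold two qubit pairs, each in state $\rho$, with joint state $\rho^{\mathrm J}=\rho\otimes\rho$. The first pair consists of qubits 1 and 2 and the second pair of qubits 3 and 4; Alice holds qubits 1 and 3, Bob holds qubits 2 and 4. A distillation operation $\mathcal{D}$ is a quantum operation (completely positive, trace-non-increasing map) on the four qubits, describing the "success" outcome, that is implementable by local operations and classical communication (LOCC) between Alice and Bob. The first pair is kept upon success. The success probability is $P_{\mathcal{D}}(\rho)=\mathrm{tr}\{\mathcal{D}\{\rho^{\mathrm J}\}\}$, and (when this is nonzero) the density matrix of the kept pair is $$\rho_{\mathrm{out}}=\frac{\mathrm{tr}_{3,4}\{\mathcal{D}\{\rho^{\mathrm J}\}\}}{\mathrm{tr}\{\mathcal{D}\{\rho^{\mathrm J}\}\}},$$ where $\mathrm{tr}_{3,4}$ is the partial trace over qubits 3 and 4. The fidelity of the kept pair is $F_{\mathcal{D}}(\rho)=\langle\Phi^+|\rho_{\mathrm{out}}|\Phi^+\rangle$. The maximum defining $F^*(\rho)$ is over all such $\mathcal{D}$ with nonzero success probability. *)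

theory Defs
  imports Complex_Main "Jordan_Normal_Form.Matrix"
begin

section \<open>States\<close>

text \<open>Tensor products use the lexicographic order of the index pairs: the basis vector
  \<open>|x\<rangle> \<otimes> |y\<rangle>\<close> of \<open>\<complex>\<^sup>m \<otimes> \<complex>\<^sup>n\<close> has index \<open>x * n + y\<close>.\<close>

definition kron_vec :: "complex vec \<Rightarrow> complex vec \<Rightarrow> complex vec" where
  "kron_vec u v = vec (dim_vec u * dim_vec v) (\<lambda>i. u $ (i div dim_vec v) * v $ (i mod dim_vec v))"

definition kron_mat :: "complex mat \<Rightarrow> complex mat \<Rightarrow> complex mat" where
  "kron_mat A B = mat (dim_row A * dim_row B) (dim_col A * dim_col B)
     (\<lambda>(i,j). A $$ (i div dim_row B, j div dim_col B) * B $$ (i mod dim_row B, j mod dim_col B))"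

text \<open>\<open>ketbra u v\<close> is \<open>|u\<rangle>\<langle>v|\<close>.\<close>

definition ketbra :: "complex vec \<Rightarrow> complex vec \<Rightarrow> complex mat" where
  "ketbra u v = mat (dim_vec u) (dim_vec v) (\<lambda>(i,j). u $ i * cnj (v $ j))"

definition trace_mat :: "complex mat \<Rightarrow> complex" where
  "trace_mat A = (\<Sum>i<dim_row A. A $$ (i,i))"

text \<open>The order on \<^typ>\<open>complex\<close> is the partial one, in which \<open>0 \<le> z\<close> means that \<open>z\<close> is real and
  nonnegative. Hence the following condition entails that the matrix is Hermitian.\<close>

definition psd :: "nat \<Rightarrow> complex mat \<Rightarrow> bool" where
  "psd n A \<longleftrightarrow> A \<in> carrier_mat n n \<and> (\<forall>v\<in>carrier_vec n. 0 \<le> (A *\<^sub>v v) \<bullet>c v)"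

definition density_matrix :: "nat \<Rightarrow> complex mat \<Rightarrow> bool" where
  "density_matrix n \<rho> \<longleftrightarrow> psd n \<rho> \<and> trace_mat \<rho> = 1"

definition orthonormal_basis_C2 :: "complex vec \<Rightarrow> complex vec \<Rightarrow> bool" where
  "orthonormal_basis_C2 u v \<longleftrightarrow> u \<in> carrier_vec 2 \<and> v \<in> carrier_vec 2 \<and>
     u \<bullet>c u = 1 \<and> v \<bullet>c v = 1 \<and> u \<bullet>c v = 0"

definition Phi_plus :: "complex vec" where
  "Phi_plus = complex_of_real (1 / sqrt 2) \<cdot>\<^sub>v
     (kron_vec (unit_vec 2 0) (unit_vec 2 0) + kron_vec (unit_vec 2 1) (unit_vec 2 1))"

definition S_state ::
  "complex vec \<Rightarrow> complex vec \<Rightarrow> complex vec \<Rightarrow> complex vec \<Rightarrow> real \<Rightarrow> complex \<Rightarrow> complex mat" where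
  "S_state a a' b b' \<alpha> R =
     (1/2) \<cdot>\<^sub>m (ketbra (kron_vec a b) (kron_vec a b)
       + (exp (- \<i> * complex_of_real \<alpha>) * cnj R) \<cdot>\<^sub>m ketbra (kron_vec a b) (kron_vec a' b')
       + (exp (\<i> * complex_of_real \<alpha>) * R) \<cdot>\<^sub>m ketbra (kron_vec a' b') (kron_vec a b)
       + ketbra (kron_vec a' b') (kron_vec a' b'))"

section \<open>Quantum operations\<close>

text \<open>For a linear map \<open>E\<close> from \<open>n \<times> n\<close> to \<open>m \<times> m\<close> matrices, \<open>tensor_id n m k E\<close> is \<open>E \<otimes> id\<close> and
  \<open>id_tensor k n m E\<close> is \<open>id \<otimes> E\<close>, with \<open>id\<close> the identity on \<open>k \<times> k\<close> matrices. Both apply \<open>E\<close> to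
  the \<open>n \<times> n\<close> matrices obtained by fixing the row and column index of the other factor.\<close>

definition tensor_id ::
  "nat \<Rightarrow> nat \<Rightarrow> nat \<Rightarrow> (complex mat \<Rightarrow> complex mat) \<Rightarrow> complex mat \<Rightarrow> complex mat" where
  "tensor_id n m k E X = mat (m * k) (m * k) (\<lambda>(i,j).
     E (mat n n (\<lambda>(p,q). X $$ (p * k + i mod k, q * k + j mod k))) $$ (i div k, j div k))"

definition id_tensor ::
  "nat \<Rightarrow> nat \<Rightarrow> nat \<Rightarrow> (complex mat \<Rightarrow> complex mat) \<Rightarrow> complex mat \<Rightarrow> complex mat" where
  "id_tensor k n m E X = mat (k * m) (k * m) (\<lambda>(i,j).
     E (mat n n (\<lambda>(p,q). X $$ ((i div m) * n + p, (j div m) * n + q))) $$ (i mod m, j mod m))"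

definition linear_mat_map :: "nat \<Rightarrow> nat \<Rightarrow> (complex mat \<Rightarrow> complex mat) \<Rightarrow> bool" where
  "linear_mat_map n m E \<longleftrightarrow>
     (\<forall>X\<in>carrier_mat n n. E X \<in> carrier_mat m m) \<and>
     (\<forall>X\<in>carrier_mat n n. \<forall>Y\<in>carrier_mat n n. E (X + Y) = E X + E Y) \<and>
     (\<forall>X\<in>carrier_mat n n. \<forall>c. E (c \<cdot>\<^sub>m X) = c \<cdot>\<^sub>m E X)"

definition completely_positive :: "nat \<Rightarrow> nat \<Rightarrow> (complex mat \<Rightarrow> complex mat) \<Rightarrow> bool" where
  "completely_positive n m E \<longleftrightarrow> linear_mat_map n m E \<and>
     (\<forall>k X. psd (k * n) X \<longrightarrow> psd (k * m) (id_tensor k n m E X))"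

definition quantum_operation :: "nat \<Rightarrow> nat \<Rightarrow> (complex mat \<Rightarrow> complex mat) \<Rightarrow> bool" where
  "quantum_operation n m E \<longleftrightarrow> completely_positive n m E \<and>
     (\<forall>X. psd n X \<longrightarrow> trace_mat (E X) \<le> trace_mat X)"

text \<open>A quantum instrument with the outcomes \<open>0, \<dots>, r - 1\<close>. The dimension \<open>m k\<close> of the system
  after the operation may depend on the outcome \<open>k\<close>; in particular, local ancillas may be added
  and discarded.\<close>

definition instrument ::
  "nat \<Rightarrow> nat \<Rightarrow> (nat \<Rightarrow> nat) \<Rightarrow> (nat \<Rightarrow> complex mat \<Rightarrow> complex mat) \<Rightarrow> bool" where
  "instrument n r m E \<longleftrightarrow> (\<forall>k<r. completely_positive n (m k) (E k)) \<and>
     (\<forall>X\<in>carrier_mat n n. (\<Sum>k<r. trace_mat (E k X)) = trace_mat X)"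

section \<open>LOCC\<close>

text \<open>\<open>locc dA dB dA' dB' L\<close>: \<open>L\<close> is the unnormalised success branch of a protocol with finitely
  many rounds that takes a system with local dimensions \<open>dA\<close> (Alice) and \<open>dB\<close> (Bob) to one with
  local dimensions \<open>dA'\<close> and \<open>dB'\<close>. A protocol either stops, declaring success or failure, or one
  node applies an instrument to its own system and announces the outcome \<open>k\<close>, on which the rest
  of the protocol depends. Contributions of the outcomes are added entrywise.\<close>

inductive locc :: "nat \<Rightarrow> nat \<Rightarrow> nat \<Rightarrow> nat \<Rightarrow> (complex mat \<Rightarrow> complex mat) \<Rightarrow> bool" where
  success: "locc dA dB dA dB (\<lambda>X. X)"
| failure: "locc dA dB dA' dB' (\<lambda>X. 0\<^sub>m (dA' * dB') (dA' * dB'))"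
| alice: "instrument dA r m E \<Longrightarrow> (\<And>k. k < r \<Longrightarrow> locc (m k) dB dA' dB' (L k)) \<Longrightarrow>
    locc dA dB dA' dB' (\<lambda>X. mat (dA' * dB') (dA' * dB')
      (\<lambda>ij. \<Sum>k<r. L k (tensor_id dA (m k) dB (E k) X) $$ ij))"
| bob: "instrument dB r m E \<Longrightarrow> (\<And>k. k < r \<Longrightarrow> locc dA (m k) dA' dB' (L k)) \<Longrightarrow>
    locc dA dB dA' dB' (\<lambda>X. mat (dA' * dB') (dA' * dB')
      (\<lambda>ij. \<Sum>k<r. L k (id_tensor dA dB (m k) (E k) X) $$ ij))"

section \<open>One round of distillation\<close>

text \<open>The basis vector \<open>|x\<^sub>1 x\<^sub>2 x\<^sub>3 x\<^sub>4\<rangle>\<close> of the four qubits has index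
  \<open>8 * x\<^sub>1 + 4 * x\<^sub>2 + 2 * x\<^sub>3 + x\<^sub>4\<close>. Exchanging the qubits 2 and 3 turns the order 1, 2, 3, 4 into
  1, 3, 2, 4, in which Alice's qubits come first and Bob's second, and vice versa.\<close>

definition swap23_index :: "nat \<Rightarrow> nat" where
  "swap23_index i = 8 * (i div 8) + 4 * (i div 2 mod 2) + 2 * (i div 4 mod 2) + i mod 2"

definition swap23 :: "complex mat \<Rightarrow> complex mat" where
  "swap23 X = mat 16 16 (\<lambda>(i,j). X $$ (swap23_index i, swap23_index j))"

definition distillation_operation :: "(complex mat \<Rightarrow> complex mat) \<Rightarrow> bool" where
  "distillation_operation D \<longleftrightarrow> quantum_operation 16 16 D \<and>
     (\<exists>L. locc 4 4 4 4 L \<and> (\<forall>X\<in>carrier_mat 16 16. D X = swap23 (L (swap23 X))))"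

definition ptrace34 :: "complex mat \<Rightarrow> complex mat" where
  "ptrace34 X = mat 4 4 (\<lambda>(i,j). \<Sum>k<4. X $$ (4 * i + k, 4 * j + k))"

definition success_prob :: "(complex mat \<Rightarrow> complex mat) \<Rightarrow> complex mat \<Rightarrow> complex" where
  "success_prob D \<rho> = trace_mat (D (kron_mat \<rho> \<rho>))"

definition kept_state :: "(complex mat \<Rightarrow> complex mat) \<Rightarrow> complex mat \<Rightarrow> complex mat" where
  "kept_state D \<rho> = (1 / trace_mat (D (kron_mat \<rho> \<rho>))) \<cdot>\<^sub>m ptrace34 (D (kron_mat \<rho> \<rho>))"

text \<open>The real part only adjusts the type: the kept state is positive semidefinite.\<close>

definition kept_fidelity :: "(complex mat \<Rightarrow> complex mat) \<Rightarrow> complex mat \<Rightarrow> real" where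
  "kept_fidelity D \<rho> = Re ((kept_state D \<rho> *\<^sub>v Phi_plus) \<bullet>c Phi_plus)"

text \<open>\<open>is_optimal_fidelity \<rho> f\<close>: the maximum of the fidelity over all distillation operations with
  nonzero success probability exists and equals \<open>f\<close>.\<close>

definition is_optimal_fidelity :: "complex mat \<Rightarrow> real \<Rightarrow> bool" where
  "is_optimal_fidelity \<rho> f \<longleftrightarrow>
     (\<exists>D. distillation_operation D \<and> success_prob D \<rho> \<noteq> 0 \<and> kept_fidelity D \<rho> = f) \<and>
     (\<forall>D. distillation_operation D \<and> success_prob D \<rho> \<noteq> 0 \<longrightarrow> kept_fidelity D \<rho> \<le> f)"

end

(* Absorb the phase of R into a'. Then rho = F |v><v| + (1 - F) |w><w| with v, w = (|ab> +- |a'b'>) / sqrt 2,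
   and with the classically correlated sigma = |ab><ab| + |a'b'><a'b'| = |v><v| + |w><w| one has
     (1 - F)^2 sigma (x) sigma <= rho (x) rho <= F^2 sigma (x) sigma.
   A distillation operation D preserves these inequalities. It also maps the separable matrix sigma (x) sigma
   to a separable one, which has at most half of its trace on the target Bell state. So with e the weight of
   D (rho (x) rho) on the Bell state and g the rest of its trace, (1 - F)^2 e <= F^2 g.
   The bound is attained when each node applies a CNOT to its two qubits, measures the control in the
   Hadamard basis, and both see the first outcome: this removes the terms in which v and w are mixed. *)

theory Submission
  imports Defs "Jordan_Normal_Form.Determinant"
begin

text \<open>LOCC enters the upper bound through one fact: separable inputs stay separable. Since
  separability is a matter of finite sums of products of positive semidefinite factors, each
  completely positive outcome can be applied to a factor directly, with no Kraus form of the
  instruments, whose local dimensions vary. The comparison with sigma is needed because the input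
  itself is entangled as soon as \<open>R \<noteq> 0\<close>. Write w for the Bell weight of D
  (sigma (x) sigma) and t for its trace. The upper inequality gives e \<le> F^2 w, the lower one g
  \<ge> (1 - F)^2 (t - w), and separability gives w \<le> t - w; chaining them yields the claim
  whatever the success probability is. Both matrix inequalities rest on F \<ge> 1/2, which orders
  the weights F^2, F (1 - F), (1 - F)^2 of the input. The protocol makes the chain tight: it sends v
  (x) v to Phi+ and w (x) w to Phi-, with probability 1/2 each. Two tensor orders compete
  throughout: the state is a product over the two pairs, while LOCC sees a product over the two
  nodes. \<open>swap23\<close> mediates between them.\<close>

section \<open>Index arithmetic for the lexicographic order\<close>

lemma sum_lessThan_mult:
  fixes f :: "nat \<Rightarrow> 'a::comm_monoid_add"
  shows "(\<Sum>x<k * m. f x) = (\<Sum>i<k. \<Sum>j<m. f (i * m + j))"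
proof (induction k)
  case (Suc k)
  have "{..<Suc k * m} = {..<k * m} \<union> {k * m..<k * m + m}" by auto
  then have "(\<Sum>x<Suc k * m. f x) = (\<Sum>x<k * m. f x) + (\<Sum>x\<in>{k * m..<k * m + m}. f x)"
    by (simp add: sum.union_disjoint ivl_disj_int)
  moreover have "(\<Sum>x\<in>{k * m..<k * m + m}. f x) = (\<Sum>j<m. f (k * m + j))"
    using sum.shift_bounds_nat_ivl[of f 0 "k * m" m] by (simp add: lessThan_atLeast0 add.commute)
  ultimately show ?case using Suc by simp
qed simp

lemma div_mod_less_mult:
  assumes "i < k * (m::nat)"
  shows "i div m < k" and "i mod m < m"
proof -
  show "i div m < k" using assms by (simp add: less_mult_imp_div_less)
  have "m > 0" using assms by (cases m) auto
  then show "i mod m < m" by simp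
qed

lemma mult_add_less: "i < k \<Longrightarrow> j < m \<Longrightarrow> i * m + j < k * (m::nat)"
  by (metis add.commute add_less_cancel_left less_le_trans mult_Suc mult_le_mono1 Suc_leI)

section \<open>Adjoints and Kronecker products\<close>

definition adjoint :: "complex mat \<Rightarrow> complex mat" where
  "adjoint A = mat (dim_col A) (dim_row A) (\<lambda>(i,j). cnj (A $$ (j,i)))"

lemma adjoint_carrier [simp, intro]: "A \<in> carrier_mat n m \<Longrightarrow> adjoint A \<in> carrier_mat m n"
  by (auto simp: adjoint_def)

lemma dim_adjoint [simp]: "dim_row (adjoint A) = dim_col A" "dim_col (adjoint A) = dim_row A"
  by (auto simp: adjoint_def)

lemma index_adjoint [simp]:
  "i < dim_col A \<Longrightarrow> j < dim_row A \<Longrightarrow> adjoint A $$ (i,j) = cnj (A $$ (j,i))"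
  by (auto simp: adjoint_def)

lemma index_mult_mat_sum:
  "A \<in> carrier_mat n k \<Longrightarrow> B \<in> carrier_mat k m \<Longrightarrow> i < n \<Longrightarrow> j < m \<Longrightarrow>
    (A * B) $$ (i,j) = (\<Sum>x<k. A $$ (i,x) * B $$ (x,j))"
  by (auto simp: scalar_prod_def lessThan_atLeast0)

lemma adjoint_mult:
  assumes A: "A \<in> carrier_mat n k" and B: "B \<in> carrier_mat k m"
  shows "adjoint (A * B) = adjoint B * adjoint A"
proof (rule eq_matI)
  fix i j assume "i < dim_row (adjoint B * adjoint A)" "j < dim_col (adjoint B * adjoint A)"
  then have ij: "i < m" "j < n" using A B by auto
  have "(adjoint B * adjoint A) $$ (i,j) = (\<Sum>x<k. adjoint B $$ (i,x) * adjoint A $$ (x,j))"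
    using ij A B by (intro index_mult_mat_sum) auto
  also have "\<dots> = cnj ((A * B) $$ (j,i))"
    using ij A B by (simp add: index_mult_mat_sum[OF A B] del: index_mult_mat(1))
      (intro sum.cong, auto)
  finally show "adjoint (A * B) $$ (i,j) = (adjoint B * adjoint A) $$ (i,j)"
    using ij A B by simp
qed (use A B in auto)

lemma kron_mat_carrier [simp, intro]:
  "A \<in> carrier_mat n m \<Longrightarrow> B \<in> carrier_mat p q \<Longrightarrow> kron_mat A B \<in> carrier_mat (n * p) (m * q)"
  by (auto simp: kron_mat_def)

lemma dim_kron_mat [simp]:
  "dim_row (kron_mat A B) = dim_row A * dim_row B" "dim_col (kron_mat A B) = dim_col A * dim_col B"
  by (auto simp: kron_mat_def)

lemma index_kron_mat:
  "A \<in> carrier_mat n m \<Longrightarrow> B \<in> carrier_mat p q \<Longrightarrow> i < n * p \<Longrightarrow> j < m * q \<Longrightarrow>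
    kron_mat A B $$ (i,j) = A $$ (i div p, j div q) * B $$ (i mod p, j mod q)"
  by (auto simp: kron_mat_def)

lemma kron_mat_mult:
  assumes A: "A \<in> carrier_mat n k" and B: "B \<in> carrier_mat p l"
    and C: "C \<in> carrier_mat k m" and D: "D \<in> carrier_mat l q"
  shows "kron_mat A B * kron_mat C D = kron_mat (A * C) (B * D)"
proof (rule eq_matI)
  fix i j assume "i < dim_row (kron_mat (A * C) (B * D))" "j < dim_col (kron_mat (A * C) (B * D))"
  then have ij: "i < n * p" "j < m * q" using A B C D by auto
  note ij' = div_mod_less_mult[OF ij(1)] div_mod_less_mult[OF ij(2)]
  have "(kron_mat A B * kron_mat C D) $$ (i,j)
      = (\<Sum>x<k * l. kron_mat A B $$ (i,x) * kron_mat C D $$ (x,j))"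
    using ij A B C D by (intro index_mult_mat_sum) auto
  also have "\<dots> = (\<Sum>x<k. \<Sum>y<l. (A $$ (i div p, x) * C $$ (x, j div q)) *
      (B $$ (i mod p, y) * D $$ (y, j mod q)))"
    unfolding sum_lessThan_mult
    by (intro sum.cong refl)
      (auto simp: index_kron_mat[OF A B] index_kron_mat[OF C D] ij mult_add_less)
  also have "\<dots> = (A * C) $$ (i div p, j div q) * (B * D) $$ (i mod p, j mod q)"
    using ij' by (simp add: index_mult_mat_sum[OF A C] index_mult_mat_sum[OF B D] sum_product
        del: index_mult_mat(1))
  also have "\<dots> = kron_mat (A * C) (B * D) $$ (i,j)"
    using ij A B C D by (intro index_kron_mat[symmetric]) auto
  finally show "(kron_mat A B * kron_mat C D) $$ (i,j) = kron_mat (A * C) (B * D) $$ (i,j)" .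
qed (use A B C D in auto)

lemma adjoint_kron_mat: "adjoint (kron_mat A B) = kron_mat (adjoint A) (adjoint B)"
proof (rule eq_matI)
  fix i j
  assume "i < dim_row (kron_mat (adjoint A) (adjoint B))"
    "j < dim_col (kron_mat (adjoint A) (adjoint B))"
  then have ij: "i < dim_col A * dim_col B" "j < dim_row A * dim_row B" by auto
  show "adjoint (kron_mat A B) $$ (i,j) = kron_mat (adjoint A) (adjoint B) $$ (i,j)"
    using ij div_mod_less_mult[OF ij(1)] div_mod_less_mult[OF ij(2)]
    by (simp add: kron_mat_def)
qed auto

lemma kron_mat_one: "kron_mat (1\<^sub>m n) (1\<^sub>m m) = 1\<^sub>m (n * m)"
proof (rule eq_matI)
  fix i j assume "i < dim_row (1\<^sub>m (n * m))" "j < dim_col (1\<^sub>m (n * m))"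
  then have ij: "i < n * m" "j < n * m" by auto
  have "i div m = j div m \<and> i mod m = j mod m \<longleftrightarrow> i = j"
    by (metis div_mult_mod_eq)
  then show "kron_mat (1\<^sub>m n) (1\<^sub>m m) $$ (i,j) = 1\<^sub>m (n * m) $$ (i,j)"
    using ij div_mod_less_mult[OF ij(1)] div_mod_less_mult[OF ij(2)]
    by (auto simp: kron_mat_def)
qed auto

section \<open>Positive semidefinite matrices\<close>

lemma cscalar_prod_sum: "w \<in> carrier_vec n \<Longrightarrow> v \<bullet>c w = (\<Sum>i<n. v $ i * cnj (w $ i))"
  by (auto simp: scalar_prod_def lessThan_atLeast0)

lemma quadratic_form_sum:
  assumes "A \<in> carrier_mat n n" "v \<in> carrier_vec n"
  shows "(A *\<^sub>v v) \<bullet>c v = (\<Sum>i<n. \<Sum>j<n. A $$ (i,j) * v $ j * cnj (v $ i))"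
  using assms by (auto simp: scalar_prod_def lessThan_atLeast0 sum_distrib_right intro!: sum.cong)

lemma psd_carrier: "psd n A \<Longrightarrow> A \<in> carrier_mat n n"
  by (simp add: psd_def)

lemma psdI:
  assumes "A \<in> carrier_mat n n"
    and "\<And>v. v \<in> carrier_vec n \<Longrightarrow> 0 \<le> (\<Sum>i<n. \<Sum>j<n. A $$ (i,j) * v $ j * cnj (v $ i))"
  shows "psd n A"
  using assms by (auto simp: psd_def quadratic_form_sum)

text \<open>The test vector is given as a function on indices, so that sparse vectors and
  pulled-back vectors can be plugged in without carrier conditions.\<close>

lemma psd_sum_nonneg:
  assumes "psd n A"
  shows "0 \<le> (\<Sum>i<n. \<Sum>j<n. A $$ (i,j) * f j * cnj (f i))"
proof -
  have "0 \<le> (A *\<^sub>v vec n f) \<bullet>c vec n f" using assms by (auto simp: psd_def)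
  also have "\<dots> = (\<Sum>i<n. \<Sum>j<n. A $$ (i,j) * f j * cnj (f i))"
    by (subst quadratic_form_sum[OF psd_carrier[OF assms]]) auto
  finally show ?thesis .
qed

lemma psd_add: "psd n A \<Longrightarrow> psd n B \<Longrightarrow> psd n (A + B)"
  using psd_carrier[of n A] psd_carrier[of n B]
  by (auto simp: psd_def add_mult_distrib_mat_vec add_scalar_prod_distrib[of _ n])

lemma psd_smult: "psd n A \<Longrightarrow> 0 \<le> c \<Longrightarrow> psd n (c \<cdot>\<^sub>m A)"
  using psd_carrier[of n A] psd_sum_nonneg[of n A]
  by (auto intro!: psdI mult_nonneg_nonneg simp: mult.assoc simp flip: sum_distrib_left)

lemma complex_mult_cnj_nonneg: "0 \<le> (z::complex) * cnj z"
  by (simp add: complex_mult_cnj less_eq_complex_def)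

lemma ketbra_carrier [simp, intro]:
  "u \<in> carrier_vec n \<Longrightarrow> v \<in> carrier_vec m \<Longrightarrow> ketbra u v \<in> carrier_mat n m"
  by (auto simp: ketbra_def)

lemma dim_ketbra [simp]: "dim_row (ketbra u v) = dim_vec u" "dim_col (ketbra u v) = dim_vec v"
  by (auto simp: ketbra_def)

lemma index_ketbra [simp]:
  "i < dim_vec u \<Longrightarrow> j < dim_vec v \<Longrightarrow> ketbra u v $$ (i,j) = u $ i * cnj (v $ j)"
  by (auto simp: ketbra_def)

lemma psd_ketbra:
  assumes u: "u \<in> carrier_vec n"
  shows "psd n (ketbra u u)"
proof (rule psdI)
  fix v :: "complex vec"
  assume "v \<in> carrier_vec n"
  have "(\<Sum>i<n. \<Sum>j<n. ketbra u u $$ (i,j) * v $ j * cnj (v $ i))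
      = (\<Sum>i<n. u $ i * cnj (v $ i)) * cnj (\<Sum>i<n. u $ i * cnj (v $ i))"
    using u by (auto simp: sum_product intro!: sum.cong)
  then show "0 \<le> (\<Sum>i<n. \<Sum>j<n. ketbra u u $$ (i,j) * v $ j * cnj (v $ i))"
    using complex_mult_cnj_nonneg by metis
qed (use u in auto)

text \<open>A single Kraus operator is enough here: the success branch of the optimal protocol keeps
  one outcome of one pure measurement per node.\<close>

definition kraus_map :: "complex mat \<Rightarrow> complex mat \<Rightarrow> complex mat" where
  "kraus_map K X = K * X * adjoint K"

lemma kraus_map_carrier [simp, intro]:
  "K \<in> carrier_mat m n \<Longrightarrow> kraus_map K X \<in> carrier_mat m m"
  unfolding kraus_map_def by (rule carrier_matI) auto

lemma index_kraus_map:
  assumes K: "K \<in> carrier_mat m n" and X: "X \<in> carrier_mat n n" and "i < m" "j < m"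
  shows "kraus_map K X $$ (i,j) = (\<Sum>p<n. \<Sum>q<n. K $$ (i,p) * X $$ (p,q) * cnj (K $$ (j,q)))"
proof -
  have "kraus_map K X $$ (i,j) = (\<Sum>q<n. (K * X) $$ (i,q) * adjoint K $$ (q,j))"
    unfolding kraus_map_def using assms by (intro index_mult_mat_sum) auto
  also have "\<dots> = (\<Sum>q<n. \<Sum>p<n. K $$ (i,p) * X $$ (p,q) * cnj (K $$ (j,q)))"
    using assms
    by (simp add: index_mult_mat_sum[OF K X] sum_distrib_right del: index_mult_mat(1))
  finally show ?thesis by (subst sum.swap)
qed

lemma psd_kraus_map:
  assumes K: "K \<in> carrier_mat m n" and X: "psd n X"
  shows "psd m (kraus_map K X)"
proof (rule psdI)
  fix v :: "complex vec" assume "v \<in> carrier_vec m"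
  \<comment> \<open>\<open>w\<close> is the adjoint of \<open>K\<close> applied to \<open>v\<close>:
    the form of the image at \<open>v\<close> is the form of \<open>X\<close> at
    \<open>w\<close>.\<close>
  define w where "w q = (\<Sum>j<m. cnj (K $$ (j,q)) * v $ j)" for q
  have "(\<Sum>i<m. \<Sum>j<m. kraus_map K X $$ (i,j) * v $ j * cnj (v $ i))
     = (\<Sum>i<m. \<Sum>j<m. \<Sum>p<n. \<Sum>q<n. K $$ (i,p) * X $$ (p,q) * cnj (K $$ (j,q)) * v $ j * cnj (v $ i))"
    by (simp add: index_kraus_map[OF K psd_carrier[OF X]] sum_distrib_right)
  also have "\<dots> = (\<Sum>i<m. \<Sum>p<n. \<Sum>q<n. \<Sum>j<m. K $$ (i,p) * X $$ (p,q) * cnj (K $$ (j,q)) * v $ j * cnj (v $ i))"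
    by (rule sum.cong[OF refl], subst sum.swap, rule sum.cong[OF refl], subst sum.swap) simp
  also have "\<dots> = (\<Sum>p<n. \<Sum>q<n. \<Sum>i<m. \<Sum>j<m. K $$ (i,p) * X $$ (p,q) * cnj (K $$ (j,q)) * v $ j * cnj (v $ i))"
    by (subst sum.swap, rule sum.cong[OF refl], subst sum.swap) simp
  also have "\<dots> = (\<Sum>p<n. \<Sum>q<n. X $$ (p,q) * w q * cnj (w p))"
    unfolding w_def
    by (intro sum.cong refl, simp add: sum_distrib_left sum_distrib_right)
      (intro sum.cong refl, simp add: mult_ac)
  finally show "0 \<le> (\<Sum>i<m. \<Sum>j<m. kraus_map K X $$ (i,j) * v $ j * cnj (v $ i))"
    using psd_sum_nonneg[OF X] by simp
qed (use K in auto)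

text \<open>Test vectors supported on two coordinates. This is the only way in which off-diagonal
  entries are controlled later on.\<close>

lemma psd_minor_nonneg:
  assumes A: "psd n A" and ij: "i < n" "j < n" "i \<noteq> j"
  shows "0 \<le> A $$ (i,i) * z * cnj z + A $$ (i,j) * w * cnj z
    + A $$ (j,i) * z * cnj w + A $$ (j,j) * w * cnj w"
proof -
  define f where "f x = (if x = i then z else if x = j then w else 0)" for x
  have "(\<Sum>x<n. \<Sum>y<n. A $$ (x,y) * f y * cnj (f x))
      = (\<Sum>x\<in>{i,j}. \<Sum>y\<in>{i,j}. A $$ (x,y) * f y * cnj (f x))"
    using ij by (intro sum.mono_neutral_cong_right) (auto simp: f_def)
  also have "\<dots> = A $$ (i,i) * z * cnj z + A $$ (i,j) * w * cnj z
      + A $$ (j,i) * z * cnj w + A $$ (j,j) * w * cnj w"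
    using ij by (simp add: f_def)
  finally show ?thesis using psd_sum_nonneg[OF A, of f] by simp
qed

lemma psd_diag_nonneg:
  assumes "psd n A" "i < n"
  shows "0 \<le> A $$ (i,i)"
proof -
  define f :: "nat \<Rightarrow> complex" where "f x = (if x = i then 1 else 0)" for x
  have "(\<Sum>x<n. \<Sum>y<n. A $$ (x,y) * f y * cnj (f x))
      = (\<Sum>x\<in>{i}. \<Sum>y\<in>{i}. A $$ (x,y) * f y * cnj (f x))"
    using assms(2) by (intro sum.mono_neutral_cong_right) (auto simp: f_def)
  then show ?thesis using psd_sum_nonneg[OF assms(1), of f] by (simp add: f_def)
qed

section \<open>Kraus maps\<close>

lemma linear_kraus_map: "K \<in> carrier_mat m n \<Longrightarrow> linear_mat_map n m (kraus_map K)"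
  unfolding linear_mat_map_def kraus_map_def
  by (auto simp: mult_add_distrib_mat[of _ m n] add_mult_distrib_mat[of _ m n _ _ m]
      mult_smult_distrib[of _ m n] mult_smult_assoc_mat[of _ m n _ m])

text \<open>Row \<open>i\<close> of the product vanishes outside the block \<open>i div m\<close>,
  so summing against it only sees that block. This is the block which \<open>id_tensor\<close> cuts
  out.\<close>

lemma sum_kron_one_left:
  assumes K: "K \<in> carrier_mat m n" and i: "i < k * m"
  shows "(\<Sum>x<k * n. kron_mat (1\<^sub>m k) K $$ (i,x) * f x)
    = (\<Sum>p<n. K $$ (i mod m, p) * f ((i div m) * n + p))"
proof -
  have "(\<Sum>x<k * n. kron_mat (1\<^sub>m k) K $$ (i,x) * f x)
      = (\<Sum>y<k. if y = i div m then (\<Sum>p<n. K $$ (i mod m, p) * f (y * n + p)) else 0)"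
    unfolding sum_lessThan_mult
    by (intro sum.cong refl)
      (auto simp: index_kron_mat[OF one_carrier_mat K] i mult_add_less div_mod_less_mult[OF i])
  also have "\<dots> = (\<Sum>p<n. K $$ (i mod m, p) * f ((i div m) * n + p))"
    using div_mod_less_mult[OF i] by simp
  finally show ?thesis .
qed

lemma sum_kron_one_right:
  assumes K: "K \<in> carrier_mat m n" and i: "i < m * k"
  shows "(\<Sum>x<n * k. kron_mat K (1\<^sub>m k) $$ (i,x) * f x)
    = (\<Sum>p<n. K $$ (i div k, p) * f (p * k + i mod k))"
proof -
  have "(\<Sum>x<n * k. kron_mat K (1\<^sub>m k) $$ (i,x) * f x)
      = (\<Sum>p<n. \<Sum>y<k. if y = i mod k then K $$ (i div k, p) * f (p * k + y) else 0)"
    unfolding sum_lessThan_mult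
    by (intro sum.cong refl)
      (auto simp: index_kron_mat[OF K one_carrier_mat] i mult_add_less div_mod_less_mult[OF i])
  also have "\<dots> = (\<Sum>p<n. K $$ (i div k, p) * f (p * k + i mod k))"
    using div_mod_less_mult[OF i] by simp
  finally show ?thesis .
qed

text \<open>The inner sum is put under \<open>cnj\<close> so that both sums have the shape of a row
  of \<open>K\<close> against a function; the two lemmas on rows of \<open>kron_mat\<close> then
  rewrite each of them.\<close>

lemma index_kraus_map':
  assumes "K \<in> carrier_mat m n" "X \<in> carrier_mat n n" "i < m" "j < m"
  shows "kraus_map K X $$ (i,j)
    = (\<Sum>p<n. K $$ (i,p) * cnj (\<Sum>q<n. K $$ (j,q) * cnj (X $$ (p,q))))"
  using assms by (auto simp: index_kraus_map sum_distrib_left mult_ac intro!: sum.cong)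

lemma id_tensor_kraus_map:
  assumes K: "K \<in> carrier_mat m n" and X: "X \<in> carrier_mat (k * n) (k * n)"
  shows "id_tensor k n m (kraus_map K) X = kraus_map (kron_mat (1\<^sub>m k) K) X"
proof (rule eq_matI)
  have IK: "kron_mat (1\<^sub>m k) K \<in> carrier_mat (k * m) (k * n)" using K by auto
  fix i j
  assume "i < dim_row (kraus_map (kron_mat (1\<^sub>m k) K) X)"
    "j < dim_col (kraus_map (kron_mat (1\<^sub>m k) K) X)"
  then have ij: "i < k * m" "j < k * m" using K by (auto simp: kraus_map_def)
  note ij' = div_mod_less_mult[OF ij(1)] div_mod_less_mult[OF ij(2)]
  show "id_tensor k n m (kraus_map K) X $$ (i,j) = kraus_map (kron_mat (1\<^sub>m k) K) X $$ (i,j)"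
    using ij ij' unfolding id_tensor_def
    by (simp add: index_kraus_map'[OF K] index_kraus_map'[OF IK X]
        sum_kron_one_left[OF K])
qed (use K in \<open>auto simp: id_tensor_def kraus_map_def\<close>)

lemma tensor_id_kraus_map:
  assumes K: "K \<in> carrier_mat m n" and X: "X \<in> carrier_mat (n * k) (n * k)"
  shows "tensor_id n m k (kraus_map K) X = kraus_map (kron_mat K (1\<^sub>m k)) X"
proof (rule eq_matI)
  have IK: "kron_mat K (1\<^sub>m k) \<in> carrier_mat (m * k) (n * k)" using K by auto
  fix i j
  assume "i < dim_row (kraus_map (kron_mat K (1\<^sub>m k)) X)"
    "j < dim_col (kraus_map (kron_mat K (1\<^sub>m k)) X)"
  then have ij: "i < m * k" "j < m * k" using K by (auto simp: kraus_map_def)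
  note ij' = div_mod_less_mult[OF ij(1)] div_mod_less_mult[OF ij(2)]
  show "tensor_id n m k (kraus_map K) X $$ (i,j) = kraus_map (kron_mat K (1\<^sub>m k)) X $$ (i,j)"
    using ij ij' unfolding tensor_id_def
    by (simp add: index_kraus_map'[OF K] index_kraus_map'[OF IK X]
        sum_kron_one_right[OF K])
qed (use K in \<open>auto simp: tensor_id_def kraus_map_def\<close>)

lemma completely_positive_kraus_map:
  assumes K: "K \<in> carrier_mat m n"
  shows "completely_positive n m (kraus_map K)"
  unfolding completely_positive_def
proof (intro conjI allI impI)
  show "linear_mat_map n m (kraus_map K)" by (rule linear_kraus_map[OF K])
  fix k X assume X: "psd (k * n) X"
  show "psd (k * m) (id_tensor k n m (kraus_map K) X)"
    unfolding id_tensor_kraus_map[OF K psd_carrier[OF X]]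
    using K X by (intro psd_kraus_map) auto
qed

text \<open>Complete positivity with a one-dimensional ancilla.\<close>

lemma completely_positive_psd:
  assumes E: "completely_positive n m E" and X: "psd n X"
  shows "psd m (E X)"
proof -
  have EX: "E X \<in> carrier_mat m m"
    using E psd_carrier[OF X] by (auto simp: completely_positive_def linear_mat_map_def)
  have "mat n n (\<lambda>(p,q). X $$ (p,q)) = X"
    using psd_carrier[OF X] by (intro eq_matI) auto
  then have "id_tensor 1 n m E X = E X"
    using EX by (intro eq_matI) (auto simp: id_tensor_def)
  moreover have "psd (1 * m) (id_tensor 1 n m E X)"
    using E X unfolding completely_positive_def by (metis mult_1)
  ultimately show ?thesis by simp
qed

lemma kraus_map_mult:
  assumes "A \<in> carrier_mat n k" "B \<in> carrier_mat k m" "X \<in> carrier_mat m m"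
  shows "kraus_map A (kraus_map B X) = kraus_map (A * B) X"
proof -
  have 1: "adjoint (A * B) = adjoint B * adjoint A" by (rule adjoint_mult[OF assms(1,2)])
  have "A * (B * X * adjoint B) * adjoint A = A * B * X * (adjoint B * adjoint A)"
    using assms
    by (smt (verit) adjoint_carrier assoc_mult_mat mult_carrier_mat)
  then show ?thesis unfolding kraus_map_def 1 .
qed

lemma trace_mat_comm:
  assumes "A \<in> carrier_mat n m" "B \<in> carrier_mat m n"
  shows "trace_mat (A * B) = trace_mat (B * A)"
proof -
  have "trace_mat (A * B) = (\<Sum>i<n. \<Sum>j<m. A $$ (i,j) * B $$ (j,i))"
    using assms unfolding trace_mat_def
    by (simp add: index_mult_mat_sum[OF assms] del: index_mult_mat(1))
  also have "\<dots> = (\<Sum>j<m. \<Sum>i<n. B $$ (j,i) * A $$ (i,j))"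
    by (subst sum.swap) (simp add: mult.commute)
  also have "\<dots> = trace_mat (B * A)"
    using assms unfolding trace_mat_def
    by (simp add: index_mult_mat_sum[OF assms(2,1)] del: index_mult_mat(1))
  finally show ?thesis .
qed

lemma trace_kraus_map_isometry:
  assumes V: "V \<in> carrier_mat m n" "adjoint V * V = 1\<^sub>m n" and X: "X \<in> carrier_mat n n"
  shows "trace_mat (kraus_map V X) = trace_mat X"
proof -
  have "trace_mat (kraus_map V X) = trace_mat (adjoint V * (V * X))"
    unfolding kraus_map_def using V X by (intro trace_mat_comm) auto
  also have "adjoint V * (V * X) = X"
    using assms by (subst assoc_mult_mat[symmetric]) auto
  finally show ?thesis .
qed

section \<open>Measurements in the computational basis after an isometry\<close>

text \<open>This is the projector onto the basis vectors with index in \<open>S\<close>, multiplied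
  by \<open>V\<close>: the Kraus operator for applying \<open>V\<close> and then finding the index
  in \<open>S\<close>.\<close>

definition restrict_rows :: "nat set \<Rightarrow> complex mat \<Rightarrow> complex mat" where
  "restrict_rows S V = mat (dim_row V) (dim_col V) (\<lambda>(i,j). if i \<in> S then V $$ (i,j) else 0)"

lemma restrict_rows_carrier [simp, intro]:
  "V \<in> carrier_mat m n \<Longrightarrow> restrict_rows S V \<in> carrier_mat m n"
  by (auto simp: restrict_rows_def)

lemma index_restrict_rows [simp]:
  "V \<in> carrier_mat m n \<Longrightarrow> i < m \<Longrightarrow> j < n \<Longrightarrow>
    restrict_rows S V $$ (i,j) = (if i \<in> S then V $$ (i,j) else 0)"
  by (auto simp: restrict_rows_def)

lemma trace_kraus_map_restrict_rows:
  assumes V: "V \<in> carrier_mat m n" and X: "X \<in> carrier_mat n n"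
  shows "trace_mat (kraus_map (restrict_rows S V) X)
    = (\<Sum>i<m. if i \<in> S then kraus_map V X $$ (i,i) else 0)"
proof -
  have "kraus_map (restrict_rows S V) X \<in> carrier_mat m m" using V by auto
  then show ?thesis unfolding trace_mat_def
    by (auto simp: index_kraus_map[OF V X] index_kraus_map[OF restrict_rows_carrier[OF V] X]
        index_restrict_rows[OF V]
        intro!: sum.cong)
qed

text \<open>The two outcomes split the diagonal of the image under \<open>V\<close> into the entries
  inside and outside \<open>S\<close>, so their traces add up to the trace of that image, which is
  the trace of \<open>X\<close>.\<close>

lemma instrument_restrict_rows:
  assumes V: "V \<in> carrier_mat m n" "adjoint V * V = 1\<^sub>m n"
  shows "instrument n 2 (\<lambda>_. m) (\<lambda>k. kraus_map (restrict_rows (if k = 0 then S else - S) V))"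
  unfolding instrument_def
proof (intro conjI allI impI ballI)
  fix X :: "complex mat" assume X: "X \<in> carrier_mat n n"
  have "(\<Sum>k<2::nat. trace_mat (kraus_map (restrict_rows (if k = 0 then S else - S) V) X))
      = (\<Sum>i<m. kraus_map V X $$ (i,i))"
    by (simp add: numeral_2_eq_2 trace_kraus_map_restrict_rows[OF V(1) X] flip: sum.distrib)
      (intro sum.cong, auto)
  also have "\<dots> = trace_mat (kraus_map V X)"
    using kraus_map_carrier[OF V(1), of X] by (simp add: trace_mat_def)
  finally show "(\<Sum>k<2::nat. trace_mat (kraus_map (restrict_rows (if k = 0 then S else - S) V) X))
      = trace_mat X"
    using trace_kraus_map_isometry[OF V X] by simp
qed (use V in \<open>auto intro: completely_positive_kraus_map\<close>)

text \<open>The trace only loses the diagonal entries outside \<open>S\<close>, and these are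
  nonnegative.\<close>

lemma quantum_operation_restrict_rows:
  assumes V: "V \<in> carrier_mat m n" "adjoint V * V = 1\<^sub>m n"
  shows "quantum_operation n m (kraus_map (restrict_rows S V))"
  unfolding quantum_operation_def
proof (intro conjI allI impI)
  fix X assume X: "psd n X"
  have "trace_mat (kraus_map (restrict_rows S V) X) \<le> (\<Sum>i<m. kraus_map V X $$ (i,i))"
    unfolding trace_kraus_map_restrict_rows[OF V(1) psd_carrier[OF X]]
    using psd_diag_nonneg[OF psd_kraus_map[OF V(1) X]] by (intro sum_mono) auto
  also have "\<dots> = trace_mat (kraus_map V X)"
    using kraus_map_carrier[OF V(1), of X] by (simp add: trace_mat_def)
  finally show "trace_mat (kraus_map (restrict_rows S V) X) \<le> trace_mat X"
    using trace_kraus_map_isometry[OF V psd_carrier[OF X]] by simp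
qed (use V in \<open>auto intro: completely_positive_kraus_map\<close>)

section \<open>Separable matrices\<close>

text \<open>The cone of unnormalised separable matrices, built one product at a time so that linear
  maps are handled by induction. The zero matrix also serves as the result of a failed
  branch.\<close>

inductive separable :: "nat \<Rightarrow> nat \<Rightarrow> complex mat \<Rightarrow> bool" for m n where
  zero: "separable m n (0\<^sub>m (m * n) (m * n))"
| add_kron: "psd m P \<Longrightarrow> psd n Q \<Longrightarrow> separable m n X \<Longrightarrow> separable m n (kron_mat P Q + X)"

lemma separable_carrier: "separable m n X \<Longrightarrow> X \<in> carrier_mat (m * n) (m * n)"
  by (induction rule: separable.induct) (auto dest!: psd_carrier)

lemma separable_kron:
  assumes "psd m P" "psd n Q"
  shows "separable m n (kron_mat P Q)"
proof -
  have "kron_mat P Q + 0\<^sub>m (m * n) (m * n) = kron_mat P Q"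
    using assms[THEN psd_carrier] by auto
  then show ?thesis using separable.add_kron[OF assms separable.zero] by simp
qed

lemma separable_add: "separable m n X \<Longrightarrow> separable m n Y \<Longrightarrow> separable m n (X + Y)"
proof (induction rule: separable.induct)
  case zero
  then show ?case using separable_carrier[OF zero] by simp
next
  case (add_kron P Q X)
  have "kron_mat P Q + X + Y = kron_mat P Q + (X + Y)"
    using add_kron by (intro assoc_add_mat[of _ "m * n" "m * n"])
      (auto dest!: psd_carrier separable_carrier)
  then show ?case using add_kron by (auto intro: separable.add_kron)
qed

lemma separable_sum:
  assumes "\<And>k. k < r \<Longrightarrow> separable m n (X k)"
  shows "separable m n (mat (m * n) (m * n) (\<lambda>ij. \<Sum>k<(r::nat). X k $$ ij))"
  using assms
proof (induction r)
  case 0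
  have "mat (m * n) (m * n) (\<lambda>ij. \<Sum>k<(0::nat). X k $$ ij) = 0\<^sub>m (m * n) (m * n)"
    by (intro eq_matI) auto
  then show ?case using separable.zero by metis
next
  case (Suc r)
  have "mat (m * n) (m * n) (\<lambda>ij. \<Sum>k<Suc r. X k $$ ij)
      = mat (m * n) (m * n) (\<lambda>ij. \<Sum>k<r. X k $$ ij) + X r"
    using separable_carrier[OF Suc.prems[of r]] by (intro eq_matI) auto
  then show ?case using Suc by (auto intro: separable_add)
qed

section \<open>Local maps on sums and products, and preservation of separability\<close>

lemma linear_mat_map_zero:
  assumes "linear_mat_map n m E"
  shows "E (0\<^sub>m n n) = 0\<^sub>m m m"
proof -
  have "E (0 \<cdot>\<^sub>m 0\<^sub>m n n) = 0 \<cdot>\<^sub>m E (0\<^sub>m n n)" and E0: "E (0\<^sub>m n n) \<in> carrier_mat m m"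
    using assms unfolding linear_mat_map_def by (metis zero_carrier_mat)+
  moreover have "0 \<cdot>\<^sub>m 0\<^sub>m n n = (0\<^sub>m n n :: complex mat)" by (intro eq_matI) auto
  ultimately have "E (0\<^sub>m n n) = 0 \<cdot>\<^sub>m E (0\<^sub>m n n)" by simp
  also have "\<dots> = 0\<^sub>m m m" using E0 by (intro eq_matI) auto
  finally show ?thesis .
qed

lemma tensor_id_zero:
  assumes "linear_mat_map n m E"
  shows "tensor_id n m k E (0\<^sub>m (n * k) (n * k)) = 0\<^sub>m (m * k) (m * k)"
proof (rule eq_matI)
  fix i j assume "i < dim_row (0\<^sub>m (m * k) (m * k))" "j < dim_col (0\<^sub>m (m * k) (m * k))"
  then have ij: "i < m * k" "j < m * k" by auto
  note ij' = div_mod_less_mult[OF ij(1)] div_mod_less_mult[OF ij(2)]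
  have "mat n n (\<lambda>(p,q). 0\<^sub>m (n * k) (n * k) $$ (p * k + i mod k, q * k + j mod k)) = (0\<^sub>m n n :: complex mat)"
    using ij' by (intro eq_matI) (auto simp: mult_add_less)
  then show "tensor_id n m k E (0\<^sub>m (n * k) (n * k)) $$ (i,j) = 0\<^sub>m (m * k) (m * k) $$ (i,j)"
    using ij ij' by (simp add: tensor_id_def linear_mat_map_zero[OF assms])
qed (auto simp: tensor_id_def)

lemma tensor_id_add:
  assumes E: "linear_mat_map n m E"
    and X: "X \<in> carrier_mat (n * k) (n * k)" and Y: "Y \<in> carrier_mat (n * k) (n * k)"
  shows "tensor_id n m k E (X + Y) = tensor_id n m k E X + tensor_id n m k E Y"
proof (rule eq_matI)
  fix i j
  assume "i < dim_row (tensor_id n m k E X + tensor_id n m k E Y)"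
    "j < dim_col (tensor_id n m k E X + tensor_id n m k E Y)"
  then have ij: "i < m * k" "j < m * k" by (auto simp: tensor_id_def)
  note ij' = div_mod_less_mult[OF ij(1)] div_mod_less_mult[OF ij(2)]
  let ?block = "\<lambda>Z. mat n n (\<lambda>(p,q). Z $$ (p * k + i mod k, q * k + j mod k)) :: complex mat"
  have "?block (X + Y) = ?block X + ?block Y"
    using X Y ij' by (intro eq_matI) (auto simp: mult_add_less)
  moreover have "E (?block X + ?block Y) = E (?block X) + E (?block Y)"
    "E (?block Y) \<in> carrier_mat m m"
    using E by (auto simp: linear_mat_map_def)
  ultimately show "tensor_id n m k E (X + Y) $$ (i,j)
      = (tensor_id n m k E X + tensor_id n m k E Y) $$ (i,j)"
    using ij ij' by (simp add: tensor_id_def)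
qed (auto simp: tensor_id_def)

text \<open>Each block of the product, at fixed indices of the second factor, is a scalar multiple
  of \<open>P\<close>, and the scalar passes through \<open>E\<close>.\<close>

lemma tensor_id_kron:
  assumes E: "linear_mat_map n m E" and P: "P \<in> carrier_mat n n" and Q: "Q \<in> carrier_mat k k"
  shows "tensor_id n m k E (kron_mat P Q) = kron_mat (E P) Q"
proof (rule eq_matI)
  have EP: "E P \<in> carrier_mat m m" using E P by (auto simp: linear_mat_map_def)
  fix i j assume "i < dim_row (kron_mat (E P) Q)" "j < dim_col (kron_mat (E P) Q)"
  then have ij: "i < m * k" "j < m * k" using EP Q by auto
  note ij' = div_mod_less_mult[OF ij(1)] div_mod_less_mult[OF ij(2)]
  have "mat n n (\<lambda>(p,q). kron_mat P Q $$ (p * k + i mod k, q * k + j mod k))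
      = Q $$ (i mod k, j mod k) \<cdot>\<^sub>m P"
    using ij' P by (intro eq_matI) (auto simp: mult_add_less index_kron_mat[OF P Q])
  moreover have "E (Q $$ (i mod k, j mod k) \<cdot>\<^sub>m P) = Q $$ (i mod k, j mod k) \<cdot>\<^sub>m E P"
    using E P by (auto simp: linear_mat_map_def)
  ultimately show "tensor_id n m k E (kron_mat P Q) $$ (i,j) = kron_mat (E P) Q $$ (i,j)"
    using ij ij' EP by (simp add: tensor_id_def index_kron_mat[OF EP Q])
qed (use assms in \<open>auto simp: tensor_id_def linear_mat_map_def\<close>)

lemma id_tensor_zero:
  assumes "linear_mat_map n m E"
  shows "id_tensor k n m E (0\<^sub>m (k * n) (k * n)) = 0\<^sub>m (k * m) (k * m)"
proof (rule eq_matI)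
  fix i j assume "i < dim_row (0\<^sub>m (k * m) (k * m))" "j < dim_col (0\<^sub>m (k * m) (k * m))"
  then have ij: "i < k * m" "j < k * m" by auto
  note ij' = div_mod_less_mult[OF ij(1)] div_mod_less_mult[OF ij(2)]
  have "mat n n (\<lambda>(p,q). 0\<^sub>m (k * n) (k * n) $$ (i div m * n + p, j div m * n + q)) = (0\<^sub>m n n :: complex mat)"
    using ij' by (intro eq_matI) (auto simp: mult_add_less)
  then show "id_tensor k n m E (0\<^sub>m (k * n) (k * n)) $$ (i,j) = 0\<^sub>m (k * m) (k * m) $$ (i,j)"
    using ij ij' by (simp add: id_tensor_def linear_mat_map_zero[OF assms])
qed (auto simp: id_tensor_def)

lemma id_tensor_add:
  assumes E: "linear_mat_map n m E"
    and X: "X \<in> carrier_mat (k * n) (k * n)" and Y: "Y \<in> carrier_mat (k * n) (k * n)"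
  shows "id_tensor k n m E (X + Y) = id_tensor k n m E X + id_tensor k n m E Y"
proof (rule eq_matI)
  fix i j
  assume "i < dim_row (id_tensor k n m E X + id_tensor k n m E Y)"
    "j < dim_col (id_tensor k n m E X + id_tensor k n m E Y)"
  then have ij: "i < k * m" "j < k * m" by (auto simp: id_tensor_def)
  note ij' = div_mod_less_mult[OF ij(1)] div_mod_less_mult[OF ij(2)]
  let ?block = "\<lambda>Z. mat n n (\<lambda>(p,q). Z $$ (i div m * n + p, j div m * n + q)) :: complex mat"
  have "?block (X + Y) = ?block X + ?block Y"
    using X Y ij' by (intro eq_matI) (auto simp: mult_add_less)
  moreover have "E (?block X + ?block Y) = E (?block X) + E (?block Y)"
    "E (?block Y) \<in> carrier_mat m m"
    using E by (auto simp: linear_mat_map_def)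
  ultimately show "id_tensor k n m E (X + Y) $$ (i,j)
      = (id_tensor k n m E X + id_tensor k n m E Y) $$ (i,j)"
    using ij ij' by (simp add: id_tensor_def)
qed (auto simp: id_tensor_def)

lemma id_tensor_kron:
  assumes E: "linear_mat_map n m E" and P: "P \<in> carrier_mat k k" and Q: "Q \<in> carrier_mat n n"
  shows "id_tensor k n m E (kron_mat P Q) = kron_mat P (E Q)"
proof (rule eq_matI)
  have EQ: "E Q \<in> carrier_mat m m" using E Q by (auto simp: linear_mat_map_def)
  fix i j assume "i < dim_row (kron_mat P (E Q))" "j < dim_col (kron_mat P (E Q))"
  then have ij: "i < k * m" "j < k * m" using EQ P by auto
  note ij' = div_mod_less_mult[OF ij(1)] div_mod_less_mult[OF ij(2)]
  have "mat n n (\<lambda>(p,q). kron_mat P Q $$ (i div m * n + p, j div m * n + q))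
      = P $$ (i div m, j div m) \<cdot>\<^sub>m Q"
    using ij' Q by (intro eq_matI) (auto simp: mult_add_less index_kron_mat[OF P Q])
  moreover have "E (P $$ (i div m, j div m) \<cdot>\<^sub>m Q) = P $$ (i div m, j div m) \<cdot>\<^sub>m E Q"
    using E Q by (auto simp: linear_mat_map_def)
  ultimately show "id_tensor k n m E (kron_mat P Q) $$ (i,j) = kron_mat P (E Q) $$ (i,j)"
    using ij ij' EQ by (simp add: id_tensor_def index_kron_mat[OF P EQ])
qed (use assms in \<open>auto simp: id_tensor_def linear_mat_map_def\<close>)

text \<open>By linearity the map acts on each product separately, where it changes one factor and
  keeps it positive semidefinite.\<close>

lemma separable_tensor_id:
  assumes "completely_positive n m E" "separable n k X"
  shows "separable m k (tensor_id n m k E X)"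
  using assms(2)
proof (induction rule: separable.induct)
  have E: "linear_mat_map n m E" using assms(1) by (simp add: completely_positive_def)
  {
    case zero
    show ?case using tensor_id_zero[OF E] separable.zero by simp
  next
    case (add_kron P Q X)
    have "tensor_id n m k E (kron_mat P Q + X) = kron_mat (E P) Q + tensor_id n m k E X"
      using add_kron.hyps(1,2)[THEN psd_carrier] separable_carrier[OF add_kron.hyps(3)]
      by (simp add: tensor_id_add[OF E] tensor_id_kron[OF E] kron_mat_carrier)
    then show ?case
      using add_kron completely_positive_psd[OF assms(1)] by (auto intro: separable.add_kron)
  }
qed

lemma separable_id_tensor:
  assumes "completely_positive n m E" "separable k n X"
  shows "separable k m (id_tensor k n m E X)"
  using assms(2)
proof (induction rule: separable.induct)
  have E: "linear_mat_map n m E" using assms(1) by (simp add: completely_positive_def)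
  {
    case zero
    show ?case using id_tensor_zero[OF E] separable.zero by simp
  next
    case (add_kron P Q X)
    have "id_tensor k n m E (kron_mat P Q + X) = kron_mat P (E Q) + id_tensor k n m E X"
      using add_kron.hyps(1,2)[THEN psd_carrier] separable_carrier[OF add_kron.hyps(3)]
      by (simp add: id_tensor_add[OF E] id_tensor_kron[OF E] kron_mat_carrier)
    then show ?case
      using add_kron completely_positive_psd[OF assms(1)] by (auto intro: separable.add_kron)
  }
qed

text \<open>The state is arbitrary in the induction because the rest of a protocol starts from the
  matrix produced by the announced outcome; the outcomes are then added inside the cone.\<close>

lemma separable_locc:
  "locc dA dB dA' dB' L \<Longrightarrow> separable dA dB X \<Longrightarrow> separable dA' dB' (L X)"
proof (induction arbitrary: X rule: locc.induct)
  case (alice dA r m E dB dA' dB' L)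
  then have "\<And>k. k < r \<Longrightarrow> separable (m k) dB (tensor_id dA (m k) dB (E k) X)"
    by (auto simp: instrument_def intro: separable_tensor_id)
  with alice.IH show ?case by (intro separable_sum) auto
next
  case (bob dB r m E dA dA' dB' L)
  then have "\<And>k. k < r \<Longrightarrow> separable dA (m k) (id_tensor dA dB (m k) (E k) X)"
    by (auto simp: instrument_def intro: separable_id_tensor)
  with bob.IH show ?case by (intro separable_sum) auto
qed (auto intro: separable.zero)

section \<open>The weight of a state on the target Bell state\<close>

text \<open>The trace of \<open>(|\<Phi>\<^sup>+\<rangle>\<langle>\<Phi>\<^sup>+| \<otimes> 1) Y\<close>: the indices \<open>k\<close> and \<open>12 + k\<close> are those of
  \<open>|00\<rangle> \<otimes> |k\<rangle>\<close> and \<open>|11\<rangle> \<otimes> |k\<rangle>\<close>.\<close>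

definition bell_weight :: "complex mat \<Rightarrow> complex" where
  "bell_weight Y = (\<Sum>k<4. Y $$ (k,k) + Y $$ (k,12+k) + Y $$ (12+k,k) + Y $$ (12+k,12+k)) / 2"

lemma bell_weight_add:
  "X \<in> carrier_mat 16 16 \<Longrightarrow> Y \<in> carrier_mat 16 16 \<Longrightarrow>
    bell_weight (X + Y) = bell_weight X + bell_weight Y"
  by (simp add: bell_weight_def sum.distrib add_divide_distrib)

lemma bell_weight_smult:
  "X \<in> carrier_mat 16 16 \<Longrightarrow> bell_weight (c \<cdot>\<^sub>m X) = c * bell_weight X"
  by (simp add: bell_weight_def sum_distrib_left distrib_left)

lemma trace_mat_add:
  "X \<in> carrier_mat n n \<Longrightarrow> Y \<in> carrier_mat n n \<Longrightarrow> trace_mat (X + Y) = trace_mat X + trace_mat Y"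
  by (simp add: trace_mat_def sum.distrib)

lemma trace_mat_smult: "X \<in> carrier_mat n n \<Longrightarrow> trace_mat (c \<cdot>\<^sub>m X) = c * trace_mat X"
  by (simp add: trace_mat_def sum_distrib_left)

text \<open>Up to normalisation, each summand is the form of \<open>Y\<close> at Phi+ on the first
  pair and basis vector \<open>k\<close> on the second.\<close>

lemma bell_weight_nonneg:
  assumes "psd 16 Y"
  shows "0 \<le> bell_weight Y"
proof -
  have "0 \<le> Y $$ (k,k) + Y $$ (k,12+k) + Y $$ (12+k,k) + Y $$ (12+k,12+k)" if "k < 4" for k
    using psd_minor_nonneg[OF assms, of k "12+k" 1 1] that by simp
  then have "0 \<le> (\<Sum>k<4. Y $$ (k,k) + Y $$ (k,12+k) + Y $$ (12+k,k) + Y $$ (12+k,12+k))"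
    by (intro sum_nonneg) auto
  then show ?thesis by (simp add: bell_weight_def less_eq_complex_def)
qed

text \<open>The difference is the weight on the other vectors of an orthonormal basis of the first
  pair: Phi- (the test vector with entries 1 and -1), |01> and |10>.\<close>

lemma bell_weight_le_trace:
  assumes "psd 16 Y"
  shows "bell_weight Y \<le> trace_mat Y"
proof -
  have "0 \<le> (\<Sum>k<4. Y $$ (k,k) - Y $$ (k,12+k) - Y $$ (12+k,k) + Y $$ (12+k,12+k))"
    using psd_minor_nonneg[OF assms, of _ "12+_" 1 "-1"] by (intro sum_nonneg) simp
  moreover have "0 \<le> (\<Sum>k<4. Y $$ (4+k,4+k) + Y $$ (8+k,8+k))"
    using psd_diag_nonneg[OF assms] by (intro sum_nonneg add_nonneg_nonneg) auto
  moreover have "trace_mat Y - bell_weight Y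
      = (\<Sum>k<4. Y $$ (k,k) - Y $$ (k,12+k) - Y $$ (12+k,k) + Y $$ (12+k,12+k)) / 2
        + (\<Sum>k<4. Y $$ (4+k,4+k) + Y $$ (8+k,8+k))"
    using psd_carrier[OF assms] unfolding trace_mat_def bell_weight_def
    by (simp add: numeral_eq_Suc) (simp add: field_simps)
  ultimately have "0 \<le> trace_mat Y - bell_weight Y" by (simp add: less_eq_complex_def)
  then show ?thesis by simp
qed

text \<open>A nonnegative form on C^2 has a Hermitian matrix with nonnegative diagonal and
  determinant.\<close>

lemma nonneg_hermitian_form2:
  fixes a b c d :: complex
  assumes "\<And>z w. 0 \<le> a * z * cnj z + b * w * cnj z + c * z * cnj w + d * w * cnj w"
  shows "0 \<le> a" "0 \<le> d" "c = cnj b" "(cmod b)\<^sup>2 \<le> Re a * Re d"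
proof -
  show a: "0 \<le> a" using assms[of 1 0] by simp
  show d: "0 \<le> d" using assms[of 0 1] by simp
  have "Im (b + c) = 0" using assms[of 1 1] a d by (simp add: less_eq_complex_def)
  moreover have "Re b = Re c" using assms[of 1 \<i>] a d by (simp add: less_eq_complex_def)
  ultimately show c: "c = cnj b" by (simp add: complex_eq_iff)
  define B where "B = (cmod b)\<^sup>2"
  \<comment> \<open>Giving the second argument the phase of \<open>cnj b\<close> turns both cross
    terms into the same real number, which leaves a real quadratic form in \<open>t\<close> and
    \<open>s\<close>.\<close>
  have form: "0 \<le> Re a * t\<^sup>2 + 2 * t * s * B + Re d * s\<^sup>2 * B" for t s :: real
  proof -
    have bb: "b * cnj b = of_real B" unfolding B_def by (rule complex_norm_square[symmetric])
    have "a * of_real t * cnj (of_real t) + b * (of_real s * cnj b) * cnj (of_real t)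
        + c * of_real t * cnj (of_real s * cnj b) + d * (of_real s * cnj b) * cnj (of_real s * cnj b)
        = a * of_real (t\<^sup>2) + of_real (2 * t * s) * (b * cnj b) + d * of_real (s\<^sup>2) * (b * cnj b)"
      unfolding c by (simp add: power2_eq_square algebra_simps)
    then have "a * of_real t * cnj (of_real t) + b * (of_real s * cnj b) * cnj (of_real t)
        + c * of_real t * cnj (of_real s * cnj b) + d * (of_real s * cnj b) * cnj (of_real s * cnj b)
        = a * of_real (t\<^sup>2) + of_real (2 * t * s * B) + d * of_real (s\<^sup>2 * B)"
      unfolding bb by simp
    with assms[of "of_real t" "of_real s * cnj b"]
    have "0 \<le> Re (a * of_real (t\<^sup>2) + of_real (2 * t * s * B) + d * of_real (s\<^sup>2 * B))"
      by (simp only: less_eq_complex_def) simp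
    then show ?thesis by simp
  qed
  have B: "0 \<le> B" and ra: "0 \<le> Re a" and rd: "0 \<le> Re d"
    using a d by (auto simp: B_def less_eq_complex_def)
  have "B \<le> Re a * Re d"
  proof (cases "Re a = 0 \<or> B = 0")
    case True
    have "B = 0" if "Re a = 0"
    proof -
      \<comment> \<open>With a vanishing coefficient of \<open>t^2\<close> the form is linear in
        \<open>t\<close>. This \<open>t\<close> is negative enough to make it negative unless
        \<open>B = 0\<close>.\<close>
      have "B * (Re d + 2) \<le> 0"
        using form[of "- (Re d + 1)" 1] that by (simp add: algebra_simps)
      then show "B = 0" using B rd by (simp add: mult_le_0_iff)
    qed
    then have "B = 0" using True by blast
    then show ?thesis using ra rd by simp
  next
    case False
    \<comment> \<open>The chosen point is proportional to the minimiser in \<open>t\<close> for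
      fixed \<open>s\<close>, so the form reduces to the determinant times a positive
      factor.\<close>
    have "0 \<le> (Re a * B) * (Re a * Re d - B)"
      using form[of B "- Re a"] by (simp add: power2_eq_square algebra_simps)
    moreover have "0 < Re a * B" using False B ra by simp
    ultimately show ?thesis by (simp add: zero_le_mult_iff)
  qed
  then show "(cmod b)\<^sup>2 \<le> Re a * Re d" by (simp add: B_def)
qed

section \<open>The exchange of qubits 2 and 3\<close>

lemma less_16_cases:
  fixes i :: nat
  assumes "i < 16"
  obtains "i = 0" | "i = 1" | "i = 2" | "i = 3" | "i = 4" | "i = 5" | "i = 6" | "i = 7" | "i = 8"
    | "i = 9" | "i = 10" | "i = 11" | "i = 12" | "i = 13" | "i = 14" | "i = 15"
  using assms by (fastforce simp: numeral_eq_Suc less_Suc_eq)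

lemma swap23_index_less [simp]: "i < 16 \<Longrightarrow> swap23_index i < 16"
  by (erule less_16_cases) (simp_all add: swap23_index_def)

lemma swap23_index_swap23_index [simp]: "i < 16 \<Longrightarrow> swap23_index (swap23_index i) = i"
  by (erule less_16_cases) (simp_all add: swap23_index_def)

text \<open>The four expressions in \<open>i\<close> are the bits of the index as they appear in
  nested Kronecker products, so this is the exchange of the two middle bits in the form needed
  there.\<close>

lemma swap23_index_qubits:
  assumes "i < 16"
  shows "swap23_index i div 4 div 2 = i div 4 div 2" "swap23_index i div 4 mod 2 = i mod 4 div 2"
    "swap23_index i mod 4 div 2 = i div 4 mod 2" "swap23_index i mod 4 mod 2 = i mod 4 mod 2"
  using assms by (rule less_16_cases; simp add: swap23_index_def)+

lemma sum_swap23_index: "(\<Sum>x<16. f (swap23_index x)) = (\<Sum>x<16. f x)"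
  by (rule sum.reindex_bij_witness[of _ swap23_index swap23_index]) auto

lemma swap23_carrier [simp, intro]: "swap23 X \<in> carrier_mat 16 16"
  by (auto simp: swap23_def)

lemma dim_swap23 [simp]: "dim_row (swap23 X) = 16" "dim_col (swap23 X) = 16"
  by (auto simp: swap23_def)

lemma index_swap23 [simp]:
  "i < 16 \<Longrightarrow> j < 16 \<Longrightarrow> swap23 X $$ (i,j) = X $$ (swap23_index i, swap23_index j)"
  by (auto simp: swap23_def)

lemma swap23_swap23: "X \<in> carrier_mat 16 16 \<Longrightarrow> swap23 (swap23 X) = X"
  by (intro eq_matI) auto

lemma swap23_add:
  "X \<in> carrier_mat 16 16 \<Longrightarrow> Y \<in> carrier_mat 16 16 \<Longrightarrow> swap23 (X + Y) = swap23 X + swap23 Y"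
  by (intro eq_matI) auto

text \<open>\<open>swap23\<close> is conjugation by a permutation matrix that is its own
  inverse.\<close>

lemma swap23_mult:
  assumes "X \<in> carrier_mat 16 16" "Y \<in> carrier_mat 16 16"
  shows "swap23 (X * Y) = swap23 X * swap23 Y"
proof (rule eq_matI)
  fix i j assume "i < dim_row (swap23 X * swap23 Y)" "j < dim_col (swap23 X * swap23 Y)"
  then have ij: "i < 16" "j < 16" by auto
  have "(swap23 X * swap23 Y) $$ (i,j) = (\<Sum>x<16. swap23 X $$ (i,x) * swap23 Y $$ (x,j))"
    using ij by (intro index_mult_mat_sum) auto
  also have "\<dots> = (\<Sum>x<16. X $$ (swap23_index i,x) * Y $$ (x,swap23_index j))"
    using ij by (subst sum_swap23_index[symmetric]) (intro sum.cong, auto)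
  also have "\<dots> = (X * Y) $$ (swap23_index i,swap23_index j)"
    using ij assms by (intro index_mult_mat_sum[symmetric]) auto
  finally show "swap23 (X * Y) $$ (i,j) = (swap23 X * swap23 Y) $$ (i,j)" using ij by simp
qed auto

lemma swap23_adjoint: "X \<in> carrier_mat 16 16 \<Longrightarrow> swap23 (adjoint X) = adjoint (swap23 X)"
  by (intro eq_matI) auto

text \<open>Regroups the qubits from pairs to nodes: the factors of the first pair and the second
  pair become Alice's and Bob's.\<close>

lemma swap23_kron:
  assumes "A \<in> carrier_mat 2 2" "B \<in> carrier_mat 2 2" "C \<in> carrier_mat 2 2" "D \<in> carrier_mat 2 2"
  shows "swap23 (kron_mat (kron_mat A B) (kron_mat C D)) = kron_mat (kron_mat A C) (kron_mat B D)"
proof -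
  have index: "kron_mat (kron_mat A B) (kron_mat C D) $$ (i,j) =
      A $$ (i div 4 div 2, j div 4 div 2) * B $$ (i div 4 mod 2, j div 4 mod 2) *
      (C $$ (i mod 4 div 2, j mod 4 div 2) * D $$ (i mod 4 mod 2, j mod 4 mod 2))"
    if "i < 16" "j < 16" "A \<in> carrier_mat 2 2" "B \<in> carrier_mat 2 2" "C \<in> carrier_mat 2 2"
      "D \<in> carrier_mat 2 2" for i j and A B C D :: "complex mat"
    using that by (auto simp: kron_mat_def)
  show ?thesis
    by (rule eq_matI) (use assms in \<open>auto simp: index swap23_index_qubits mult_ac\<close>)
qed

lemma sum_lessThan_4: "(\<Sum>i<4. f i) = f 0 + f 1 + f 2 + f (3::nat)" 
  by (simp add: numeral_eq_Suc)

text \<open>With a node's basis order |00>, |01>, |10>, |11>, the four coefficients are the entries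
  of the partial trace over its second qubit. That matrix is the sum of the principal blocks of
  \<open>P\<close> on {0,2} and {1,3}.\<close>

lemma partial_trace_block:
  assumes "psd 4 P"
  shows "0 \<le> (P $$ (0,0) + P $$ (1,1)) * z * cnj z + (P $$ (0,2) + P $$ (1,3)) * w * cnj z
    + (P $$ (2,0) + P $$ (3,1)) * z * cnj w + (P $$ (2,2) + P $$ (3,3)) * w * cnj w"
  using add_nonneg_nonneg[OF psd_minor_nonneg[OF assms, of 0 2 z w]
      psd_minor_nonneg[OF assms, of 1 3 z w]]
  by (simp add: algebra_simps)

text \<open>A product matrix has at most half of its trace on Phi+. Twice the weight consists of the
  two diagonal products and a cross term; positivity of both factors bounds the cross term by the
  two missing products in the product of the traces.\<close>

lemma bell_weight_kron:
  assumes P: "psd 4 P" and Q: "psd 4 Q"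
  shows "2 * bell_weight (swap23 (kron_mat P Q)) \<le> trace_mat (swap23 (kron_mat P Q))"
proof -
  \<comment> \<open>\<open>p\<close> and \<open>q\<close> are the reduced matrices of qubits 1 and
    2. They are read only at the indices 0 and 2, which stand for |0> and |1> there.\<close>
  define p where "p i j = P $$ (i,j) + P $$ (Suc i, Suc j)" for i j
  define q where "q i j = Q $$ (i,j) + Q $$ (Suc i, Suc j)" for i j
  have pform: "0 \<le> p 0 0 * z * cnj z + p 0 2 * w * cnj z + p 2 0 * z * cnj w + p 2 2 * w * cnj w"
    for z w using partial_trace_block[OF P, of z w] by (simp add: p_def numeral_eq_Suc)
  have qform: "0 \<le> q 0 0 * z * cnj z + q 0 2 * w * cnj z + q 2 0 * z * cnj w + q 2 2 * w * cnj w"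
    for z w using partial_trace_block[OF Q, of z w] by (simp add: q_def numeral_eq_Suc)
  note p = nonneg_hermitian_form2[OF pform] and q = nonneg_hermitian_form2[OF qform]
  \<comment> \<open>\<open>f y z\<close> is the contribution in which the discarded qubits 3 and 4
    are in |y> and |z>.\<close>
  define f where "f y z = P $$ (y,y) * Q $$ (z,z) + P $$ (y,2+y) * Q $$ (z,2+z)
      + P $$ (2+y,y) * Q $$ (2+z,z) + P $$ (2+y,2+y) * Q $$ (2+z,2+z)" for y z
  have "2 * bell_weight (swap23 (kron_mat P Q)) = f 0 0 + f 0 1 + f 1 0 + f 1 1"
    unfolding bell_weight_def sum_lessThan_4 f_def
    by (simp add: index_kron_mat[OF psd_carrier[OF P] psd_carrier[OF Q]] swap23_index_def)
  also have "\<dots> = p 0 0 * q 0 0 + p 0 2 * q 0 2 + p 2 0 * q 2 0 + p 2 2 * q 2 2"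
    unfolding p_def q_def f_def by (simp add: ring_distribs eval_nat_numeral)
  finally have weight: "2 * bell_weight (swap23 (kron_mat P Q))
      = p 0 0 * q 0 0 + p 0 2 * q 0 2 + p 2 0 * q 2 0 + p 2 2 * q 2 2" .
  have "trace_mat (swap23 (kron_mat P Q)) = (\<Sum>i<4 * 4. kron_mat P Q $$ (i,i))"
    unfolding trace_mat_def using sum_swap23_index[of "\<lambda>i. kron_mat P Q $$ (i,i)"] by simp
  also have "\<dots> = (\<Sum>i<4. \<Sum>j<4. P $$ (i,i) * Q $$ (j,j))"
    unfolding sum_lessThan_mult
    by (intro sum.cong refl, subst index_kron_mat[OF psd_carrier[OF P] psd_carrier[OF Q]]) auto
  also have "\<dots> = (\<Sum>i<4. P $$ (i,i)) * (\<Sum>j<4. Q $$ (j,j))"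
    by (simp add: sum_product)
  also have "\<dots> = (p 0 0 + p 2 2) * (q 0 0 + q 2 2)"
    unfolding sum_lessThan_4 p_def q_def by (simp add: eval_nat_numeral add.assoc)
  finally have trace: "trace_mat (swap23 (kron_mat P Q)) = (p 0 0 + p 2 2) * (q 0 0 + q 2 2)" .
  define a d b a' d' b' where abbr: "a = Re (p 0 0)" "d = Re (p 2 2)" "b = p 0 2"
    "a' = Re (q 0 0)" "d' = Re (q 2 2)" "b' = q 0 2"
  have nonneg: "0 \<le> a" "0 \<le> d" "0 \<le> a'" "0 \<le> d'"
    using p(1,2) q(1,2) by (auto simp: abbr less_eq_complex_def)
  have "(cmod b * cmod b')\<^sup>2 \<le> (a * d) * (a' * d')"
    unfolding power_mult_distrib using p(4) q(4) nonneg by (intro mult_mono) (auto simp: abbr)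
  \<comment> \<open>Arithmetic and geometric mean of \<open>a * d'\<close> and
    \<open>d * a'\<close>.\<close>
  also have "\<dots> \<le> ((a * d' + d * a') / 2)\<^sup>2"
    using zero_le_power2[of "a * d' - d * a'"] by (simp add: power2_eq_square field_simps)
  finally have "cmod b * cmod b' \<le> (a * d' + d * a') / 2"
    by (rule power2_le_imp_le) (use nonneg in simp)
  then have "2 * Re (b * b') \<le> a * d' + d * a'"
    using complex_Re_le_cmod[of "b * b'"] by (simp add: norm_mult)
  moreover have "p 0 0 = of_real a" "p 2 2 = of_real d" "q 0 0 = of_real a'" "q 2 2 = of_real d'"
    "p 0 2 = b" "q 0 2 = b'" "p 2 0 = cnj b" "q 2 0 = cnj b'"
    using p q by (auto simp: abbr less_eq_complex_def complex_eq_iff)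
  ultimately show ?thesis
    unfolding weight trace by (simp add: less_eq_complex_def algebra_simps)
qed

lemma bell_weight_separable:
  "separable 4 4 X \<Longrightarrow> 2 * bell_weight (swap23 X) \<le> trace_mat (swap23 X)"
proof (induction rule: separable.induct)
  case zero
  have "swap23 (0\<^sub>m (4 * 4) (4 * 4)) = 0\<^sub>m 16 16" by (intro eq_matI) auto
  then show ?case by (simp add: bell_weight_def trace_mat_def)
next
  case (add_kron P Q X)
  have "kron_mat P Q \<in> carrier_mat 16 16" "X \<in> carrier_mat 16 16"
    using kron_mat_carrier[of P 4 4 Q 4 4] add_kron.hyps psd_carrier separable_carrier by fastforce+
  then show ?case
    using bell_weight_kron[OF add_kron.hyps(1,2)] add_kron.IH
    by (simp add: swap23_add bell_weight_add[OF swap23_carrier swap23_carrier]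
        trace_mat_add[OF swap23_carrier swap23_carrier] distrib_left add_mono)
qed

lemma of_real_sqrt2_mult: "complex_of_real (sqrt 2) * complex_of_real (sqrt 2) = 2"
  by (metis of_real_mult of_real_numeral real_sqrt_mult_self abs_numeral)

text \<open>The partial trace is moved onto the projector. The entries 0 and 3 of Phi+ turn into the
  offsets 0 and 12 of \<open>bell_weight\<close>. At zero trace both sides are 0, as division by
  zero yields 0.\<close>

lemma kept_fidelity_eq:
  assumes "D (kron_mat \<rho> \<rho>) \<in> carrier_mat 16 16"
  shows "kept_fidelity D \<rho> = Re (bell_weight (D (kron_mat \<rho> \<rho>)) / success_prob D \<rho>)"
proof -
  define Y where "Y = D (kron_mat \<rho> \<rho>)"
  define \<phi> where "\<phi> = vec 4 (\<lambda>i. if i = 0 \<or> i = 3 then complex_of_real (1 / sqrt 2) else 0)"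
  have Phi: "Phi_plus = \<phi>"
  proof (rule eq_vecI)
    fix i assume "i < dim_vec \<phi>"
    then have "i = 0 \<or> i = 1 \<or> i = 2 \<or> i = 3" by (auto simp: \<phi>_def)
    then show "Phi_plus $ i = \<phi> $ i"
      by (auto simp: Phi_plus_def kron_vec_def \<phi>_def)
  qed (simp add: Phi_plus_def kron_vec_def \<phi>_def)
  have "(kept_state D \<rho> *\<^sub>v Phi_plus) \<bullet>c Phi_plus
      = (\<Sum>i<4. \<Sum>j<4. kept_state D \<rho> $$ (i,j) * Phi_plus $ j * cnj (Phi_plus $ i))"
    by (rule quadratic_form_sum) (auto simp: kept_state_def ptrace34_def Phi \<phi>_def)
  also have "\<dots> = bell_weight Y / trace_mat Y"
    unfolding bell_weight_def
    by (simp add: sum_lessThan_4 Phi \<phi>_def kept_state_def ptrace34_def Y_def[symmetric])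
      (simp add: divide_simps of_real_sqrt2_mult, simp add: eval_nat_numeral)
  finally show ?thesis by (simp add: kept_fidelity_def success_prob_def Y_def)
qed

section \<open>The upper bound\<close>

lemma kron_vec_carrier [simp, intro]:
  "u \<in> carrier_vec n \<Longrightarrow> v \<in> carrier_vec m \<Longrightarrow> kron_vec u v \<in> carrier_vec (n * m)"
  by (intro carrier_vecI) (auto simp: kron_vec_def)

lemma dim_kron_vec [simp]: "dim_vec (kron_vec u v) = dim_vec u * dim_vec v"
  by (auto simp: kron_vec_def)

lemma index_kron_vec [simp]:
  "i < dim_vec u * dim_vec v \<Longrightarrow> kron_vec u v $ i = u $ (i div dim_vec v) * v $ (i mod dim_vec v)"
  by (auto simp: kron_vec_def)

lemma kron_mat_ketbra: "kron_mat (ketbra u x) (ketbra v y) = ketbra (kron_vec u v) (kron_vec x y)"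
proof (rule eq_matI)
  fix i j
  assume "i < dim_row (ketbra (kron_vec u v) (kron_vec x y))"
    "j < dim_col (ketbra (kron_vec u v) (kron_vec x y))"
  then have ij: "i < dim_vec u * dim_vec v" "j < dim_vec x * dim_vec y" by auto
  show "kron_mat (ketbra u x) (ketbra v y) $$ (i,j) = ketbra (kron_vec u v) (kron_vec x y) $$ (i,j)"
    using ij div_mod_less_mult[OF ij(1)] div_mod_less_mult[OF ij(2)]
    by (simp add: kron_mat_def)
qed auto

lemma psd_kron_ketbra:
  "u \<in> carrier_vec 4 \<Longrightarrow> v \<in> carrier_vec 4 \<Longrightarrow> psd 16 (kron_mat (ketbra u u) (ketbra v v))"
  unfolding kron_mat_ketbra using psd_ketbra[OF kron_vec_carrier[of u 4 v 4]] by simp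

text \<open>Used with the weights \<open>F\<close>, \<open>1 - F\<close> and with the weights 1, 1,
  so that the two copies of the state and of its classical counterpart can be compared term by
  term.\<close>

lemma kron_mat_lincomb:
  assumes "P \<in> carrier_mat n n" "M \<in> carrier_mat n n"
  shows "kron_mat (a \<cdot>\<^sub>m P + b \<cdot>\<^sub>m M) (a \<cdot>\<^sub>m P + b \<cdot>\<^sub>m M)
    = a\<^sup>2 \<cdot>\<^sub>m kron_mat P P + (a * b) \<cdot>\<^sub>m (kron_mat P M + kron_mat M P) + b\<^sup>2 \<cdot>\<^sub>m kron_mat M M"
    (is "?L = ?R")
proof (rule eq_matI)
  fix i j assume "i < dim_row ?R" "j < dim_col ?R"
  then have ij: "i < n * n" "j < n * n" using assms by auto
  show "?L $$ (i,j) = ?R $$ (i,j)"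
    using assms ij div_mod_less_mult[OF ij(1)] div_mod_less_mult[OF ij(2)]
    by (simp add: index_kron_mat[of _ n n _ n n] power2_eq_square algebra_simps)
qed (use assms in auto)

lemma kept_fidelity_le:
  fixes F :: real
  assumes D: "distillation_operation D" and prob: "success_prob D \<rho> \<noteq> 0"
    and uv: "u \<in> carrier_vec 4" "v \<in> carrier_vec 4"
    and \<rho>: "\<rho> = complex_of_real F \<cdot>\<^sub>m ketbra u u + complex_of_real (1 - F) \<cdot>\<^sub>m ketbra v v"
    and F: "1 / 2 \<le> F" "F \<le> 1"
    and sep: "separable 4 4 (swap23 (kron_mat (ketbra u u + ketbra v v) (ketbra u u + ketbra v v)))"
  shows "kept_fidelity D \<rho> \<le> F\<^sup>2 / (F\<^sup>2 + (1 - F)\<^sup>2)"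
proof -
  define P where "P = ketbra u u"
  define M where "M = ketbra v v"
  define Z where "Z = kron_mat (P + M) (P + M)"
  define Y where "Y = kron_mat \<rho> \<rho>"
  have PM: "P \<in> carrier_mat 4 4" "M \<in> carrier_mat 4 4" using uv by (auto simp: P_def M_def)
  note kron16 = kron_mat_carrier[of _ 4 4 _ 4 4, simplified]
  have Zc: "Z \<in> carrier_mat 16 16" and Yc: "Y \<in> carrier_mat 16 16"
    using PM by (auto simp: Z_def Y_def \<rho> P_def[symmetric] M_def[symmetric] intro!: kron16)
  have c16: "kron_mat P P \<in> carrier_mat 16 16" "kron_mat P M \<in> carrier_mat 16 16"
    "kron_mat M P \<in> carrier_mat 16 16" "kron_mat M M \<in> carrier_mat 16 16"
    using PM by (auto intro: kron16)
  have Zexp: "Z = kron_mat P P + (kron_mat P M + kron_mat M P) + kron_mat M M"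
  proof -
    have "1 \<cdot>\<^sub>m A = A" for A :: "complex mat" by (intro eq_matI) auto
    then show ?thesis using kron_mat_lincomb[OF PM, of 1 1] by (simp add: Z_def)
  qed
  have Yexp: "Y = (complex_of_real F)\<^sup>2 \<cdot>\<^sub>m kron_mat P P
      + (complex_of_real F * complex_of_real (1 - F)) \<cdot>\<^sub>m (kron_mat P M + kron_mat M P)
      + (complex_of_real (1 - F))\<^sup>2 \<cdot>\<^sub>m kron_mat M M"
    unfolding Y_def \<rho> P_def[symmetric] M_def[symmetric] by (rule kron_mat_lincomb[OF PM])
  \<comment> \<open>The remainders of the two matrix inequalities. Their coefficients are the
    differences of the weights F^2, F (1 - F), (1 - F)^2 from (1 - F)^2 and from F^2; the term with
    the extreme weight drops out, and \<open>1 / 2 \<le> F\<close> makes the others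
    nonnegative.\<close>
  define E1 where "E1 = complex_of_real (2 * F - 1) \<cdot>\<^sub>m kron_mat P P
      + complex_of_real ((1 - F) * (2 * F - 1)) \<cdot>\<^sub>m (kron_mat P M + kron_mat M P)"
  define E2 where "E2 = complex_of_real (F * (2 * F - 1)) \<cdot>\<^sub>m (kron_mat P M + kron_mat M P)
      + complex_of_real (2 * F - 1) \<cdot>\<^sub>m kron_mat M M"
  have E: "psd 16 E1" "psd 16 E2"
    using F uv unfolding E1_def E2_def P_def M_def
    by (auto intro!: psd_add psd_smult psd_kron_ketbra simp: less_eq_complex_def)
  have Y1: "Y = complex_of_real ((1 - F)\<^sup>2) \<cdot>\<^sub>m Z + E1"
    unfolding Zexp Yexp E1_def using PM c16
    by (intro eq_matI) (auto simp: power2_eq_square algebra_simps)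
  have Y2: "complex_of_real (F\<^sup>2) \<cdot>\<^sub>m Z = Y + E2"
    unfolding Zexp Yexp E2_def using PM c16
    by (intro eq_matI) (auto simp: power2_eq_square algebra_simps)
  have cp: "completely_positive 16 16 D"
    using D by (simp add: distillation_operation_def quantum_operation_def)
  then have lin: "linear_mat_map 16 16 D" by (simp add: completely_positive_def)
  then have Dc: "D X \<in> carrier_mat 16 16" if "X \<in> carrier_mat 16 16" for X
    using that by (simp add: linear_mat_map_def)
  have DY1: "D Y = complex_of_real ((1 - F)\<^sup>2) \<cdot>\<^sub>m D Z + D E1"
    unfolding Y1 using lin Zc psd_carrier[OF E(1)] by (simp add: linear_mat_map_def)
  have DY2: "complex_of_real (F\<^sup>2) \<cdot>\<^sub>m D Z = D Y + D E2"
    using lin Zc Yc psd_carrier[OF E(2)] Y2 by (metis linear_mat_map_def)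
  have DE: "psd 16 (D E1)" "psd 16 (D E2)" using completely_positive_psd[OF cp] E by auto
  obtain L where L: "locc 4 4 4 4 L" "\<And>X. X \<in> carrier_mat 16 16 \<Longrightarrow> D X = swap23 (L (swap23 X))"
    using D unfolding distillation_operation_def by blast
  have "separable 4 4 (L (swap23 Z))"
    using separable_locc[OF L(1)] sep by (simp add: Z_def P_def M_def)
  then have "2 * bell_weight (D Z) \<le> trace_mat (D Z)"
    using bell_weight_separable L(2)[OF Zc] by simp
  then have sepZ: "2 * Re (bell_weight (D Z)) \<le> Re (trace_mat (D Z))"
    by (simp add: less_eq_complex_def)
  have w: "F\<^sup>2 * Re (bell_weight (D Z)) = Re (bell_weight (D Y)) + Re (bell_weight (D E2))"
    using arg_cong[OF DY2, of "\<lambda>X. Re (bell_weight X)"] Dc Zc Yc E[THEN psd_carrier]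
    by (simp add: bell_weight_add bell_weight_smult del: of_real_power)
  have t: "Re (trace_mat (D Y)) = (1 - F)\<^sup>2 * Re (trace_mat (D Z)) + Re (trace_mat (D E1))"
    "Re (bell_weight (D Y)) = (1 - F)\<^sup>2 * Re (bell_weight (D Z)) + Re (bell_weight (D E1))"
    using Dc Zc Yc E[THEN psd_carrier] unfolding DY1
    by (simp_all add: bell_weight_add bell_weight_smult trace_mat_add[of _ 16]
        trace_mat_smult[of _ 16] del: of_real_power)
  have pos: "0 \<le> Re (bell_weight (D E2))" "Re (bell_weight (D E1)) \<le> Re (trace_mat (D E1))"
    using bell_weight_nonneg[OF DE(2)] bell_weight_le_trace[OF DE(1)]
    by (auto simp: less_eq_complex_def)
  define e where "e = Re (bell_weight (D Y))"
  define g where "g = Re (trace_mat (D Y)) - Re (bell_weight (D Y))"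
  have "e \<le> F\<^sup>2 * Re (bell_weight (D Z))" using w pos by (simp add: e_def)
  \<comment> \<open>Multiplying by both squares instead of dividing by them covers the pure case
    \<open>F = 1\<close>.\<close>
  then have "(1 - F)\<^sup>2 * e \<le> (1 - F)\<^sup>2 * (F\<^sup>2 * Re (bell_weight (D Z)))"
    by (intro mult_left_mono) auto
  also have "\<dots> = F\<^sup>2 * ((1 - F)\<^sup>2 * Re (bell_weight (D Z)))" by simp
  also have "\<dots> \<le> F\<^sup>2 * ((1 - F)\<^sup>2 * (Re (trace_mat (D Z)) - Re (bell_weight (D Z))))"
    using sepZ by (intro mult_left_mono) auto
  \<comment> \<open>\<open>g\<close> is the corresponding quantity for \<open>Z\<close>, scaled by
    (1 - F)^2, plus that for \<open>E1\<close>, where the weight is at most the trace.\<close>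
  also have "\<dots> \<le> F\<^sup>2 * g"
    using t pos by (intro mult_left_mono) (auto simp: g_def algebra_simps)
  finally have eg: "(1 - F)\<^sup>2 * e \<le> F\<^sup>2 * g" .
  have psdY: "psd 16 Y"
    unfolding Yexp P_def M_def using F uv
    by (intro psd_add psd_smult psd_kron_ketbra) (auto simp: less_eq_complex_def power2_eq_square)
  have e0: "0 \<le> trace_mat (D Y)"
    using psd_diag_nonneg[OF completely_positive_psd[OF cp psdY]] Dc[OF Yc]
    unfolding trace_mat_def by (intro sum_nonneg) auto
  define T where "T = Re (trace_mat (D Y))"
  have T: "trace_mat (D Y) = of_real T" using e0 by (simp add: T_def less_eq_complex_def complex_eq_iff)
  have T0: "0 < T"
    using e0 prob unfolding success_prob_def Y_def[symmetric] T by (auto simp: less_eq_complex_def)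
  have "kept_fidelity D \<rho> = e / T"
    using kept_fidelity_eq[of D \<rho>] Dc[OF Yc]
    by (simp add: Y_def[symmetric] success_prob_def T e_def)
  also have "\<dots> \<le> F\<^sup>2 / (F\<^sup>2 + (1 - F)\<^sup>2)"
  proof -
    have "0 < F\<^sup>2 + (1 - F)\<^sup>2" using F by (intro add_pos_nonneg) auto
    moreover have "e * (F\<^sup>2 + (1 - F)\<^sup>2) \<le> F\<^sup>2 * T"
      using eg by (simp add: g_def T_def e_def algebra_simps)
    ultimately show ?thesis using T0 by (simp add: divide_simps)
  qed
  finally show ?thesis .
qed

section \<open>An optimal protocol\<close>

lemma index_mult_mat_vec_sum:
  "A \<in> carrier_mat n k \<Longrightarrow> v \<in> carrier_vec k \<Longrightarrow> i < n \<Longrightarrow>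
    (A *\<^sub>v v) $ i = (\<Sum>x<k. A $$ (i,x) * v $ x)"
  by (auto simp: scalar_prod_def lessThan_atLeast0)

lemma kraus_map_ketbra:
  assumes K: "K \<in> carrier_mat m n" and v: "v \<in> carrier_vec n"
  shows "kraus_map K (ketbra v v) = ketbra (K *\<^sub>v v) (K *\<^sub>v v)"
proof (rule eq_matI)
  define w where "w = K *\<^sub>v v"
  have w: "w \<in> carrier_vec m" using K unfolding w_def by (intro carrier_vecI) simp
  fix i j assume "i < dim_row (ketbra (K *\<^sub>v v) (K *\<^sub>v v))" "j < dim_col (ketbra (K *\<^sub>v v) (K *\<^sub>v v))"
  then have ij: "i < m" "j < m" using K by simp_all
  have "kraus_map K (ketbra v v) $$ (i,j)
      = (\<Sum>p<n. \<Sum>q<n. (K $$ (i,p) * v $ p) * cnj (K $$ (j,q) * v $ q))"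
    using v by (subst index_kraus_map[OF K _ ij]) (auto simp: mult_ac intro!: sum.cong)
  also have "\<dots> = w $ i * cnj (w $ j)"
    unfolding w_def index_mult_mat_vec_sum[OF K v ij(1)] index_mult_mat_vec_sum[OF K v ij(2)]
    by (simp add: sum_product)
  finally show "kraus_map K (ketbra v v) $$ (i,j) = ketbra (K *\<^sub>v v) (K *\<^sub>v v) $$ (i,j)"
    using w ij by (simp flip: w_def)
qed (use K in \<open>simp_all add: kraus_map_def\<close>)

lemma kron_mat_mult_vec:
  assumes A: "A \<in> carrier_mat n k" and B: "B \<in> carrier_mat p l"
    and u: "u \<in> carrier_vec k" and v: "v \<in> carrier_vec l"
  shows "kron_mat A B *\<^sub>v kron_vec u v = kron_vec (A *\<^sub>v u) (B *\<^sub>v v)"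
proof (rule eq_vecI)
  fix i assume "i < dim_vec (kron_vec (A *\<^sub>v u) (B *\<^sub>v v))"
  then have i: "i < n * p" using A B by simp
  note i' = div_mod_less_mult[OF i]
  have "(kron_mat A B *\<^sub>v kron_vec u v) $ i
      = (\<Sum>x<k * l. kron_mat A B $$ (i,x) * kron_vec u v $ x)"
    using i assms by (intro index_mult_mat_vec_sum) auto
  also have "\<dots> = (\<Sum>x<k. \<Sum>y<l. (A $$ (i div p, x) * u $ x) * (B $$ (i mod p, y) * v $ y))"
    unfolding sum_lessThan_mult using u v
    by (intro sum.cong refl) (auto simp: index_kron_mat[OF A B] i mult_add_less)
  also have "\<dots> = (A *\<^sub>v u) $ (i div p) * (B *\<^sub>v v) $ (i mod p)"
    unfolding index_mult_mat_vec_sum[OF A u i'(1)] index_mult_mat_vec_sum[OF B v i'(2)] sum_product ..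
  finally show "(kron_mat A B *\<^sub>v kron_vec u v) $ i = kron_vec (A *\<^sub>v u) (B *\<^sub>v v) $ i"
    using i A B by simp
qed (use A B in auto)

lemma isometry_kron:
  assumes "A \<in> carrier_mat n k" "B \<in> carrier_mat m l"
    and "adjoint A * A = 1\<^sub>m k" "adjoint B * B = 1\<^sub>m l"
  shows "adjoint (kron_mat A B) * kron_mat A B = 1\<^sub>m (k * l)"
  unfolding adjoint_kron_mat using assms
  by (subst kron_mat_mult[of _ k n _ l m _ k _ l]) (auto simp: kron_mat_one)

lemma isometry_mult:
  assumes "A \<in> carrier_mat n m" "B \<in> carrier_mat m k"
    and "adjoint A * A = 1\<^sub>m m" "adjoint B * B = 1\<^sub>m k"
  shows "adjoint (A * B) * (A * B) = 1\<^sub>m k"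
proof -
  have "adjoint (A * B) * (A * B) = adjoint B * ((adjoint A * A) * B)"
    unfolding adjoint_mult[OF assms(1,2)] using assms(1,2)
    by (smt (verit) adjoint_carrier assoc_mult_mat mult_carrier_mat)
  then show ?thesis using assms by simp
qed

text \<open>Two local projections form one projection in the pair order, so the joint success branch
  is again an isometry restricted to some of its rows. Quotient and remainder by 4 of the exchanged
  index are Alice's and Bob's indices.\<close>

lemma restrict_rows_kron:
  assumes A: "A \<in> carrier_mat 4 4" and B: "B \<in> carrier_mat 4 4"
  shows "swap23 (kron_mat (restrict_rows S A) (restrict_rows T B)) =
    restrict_rows {i. swap23_index i div 4 \<in> S \<and> swap23_index i mod 4 \<in> T} (swap23 (kron_mat A B))"
    (is "?L = ?R")
proof (rule eq_matI)
  fix i j assume "i < dim_row ?R" "j < dim_col ?R"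
  then have ij: "i < 16" "j < 16" by (auto simp: restrict_rows_def)
  have "swap23_index k div 4 < 4" if "k < 16" for k
    by (rule less_mult_imp_div_less) (simp add: that)
  with ij show "?L $$ (i,j) = ?R $$ (i,j)"
    by (simp add: index_kron_mat[OF restrict_rows_carrier[OF A] restrict_rows_carrier[OF B]]
        index_kron_mat[OF A B] index_restrict_rows[OF A] index_restrict_rows[OF B]
        index_restrict_rows[OF swap23_carrier])
qed (auto simp: restrict_rows_def)

text \<open>Alice measures and announces; on outcome 0 Bob measures, and on his outcome 0 the
  protocol stops with success. Every other branch fails and contributes zero.\<close>

lemma locc_restrict_rows:
  assumes A: "A \<in> carrier_mat m n" "adjoint A * A = 1\<^sub>m n"
    and B: "B \<in> carrier_mat p q" "adjoint B * B = 1\<^sub>m q"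
  shows "\<exists>L. locc n q m p L \<and> (\<forall>X\<in>carrier_mat (n * q) (n * q).
    L X = kraus_map (kron_mat (restrict_rows S A) (restrict_rows T B)) X)"
proof -
  define EA where "EA k = kraus_map (restrict_rows (if k = 0 then S else - S) A)" for k :: nat
  define EB where "EB k = kraus_map (restrict_rows (if k = 0 then T else - T) B)" for k :: nat
  define fail :: "complex mat \<Rightarrow> complex mat" where "fail X = 0\<^sub>m (m * p) (m * p)" for X
  define LB where "LB X = mat (m * p) (m * p)
    (\<lambda>ij. \<Sum>k<2. (if k = 0 then \<lambda>X. X else fail) (id_tensor m q p (EB k) X) $$ ij)" for X
  define L where "L X = mat (m * p) (m * p)
    (\<lambda>ij. \<Sum>k<2. (if k = 0 then LB else fail) (tensor_id n m q (EA k) X) $$ ij)" for X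
  have fail: "locc d d' m p fail" for d d'
    unfolding fail_def by (rule locc.failure)
  have "locc m q m p LB"
    unfolding LB_def EB_def
    by (rule locc.bob[OF instrument_restrict_rows[OF B]]) (auto intro: fail locc.success)
  then have "locc n q m p L"
    unfolding L_def EA_def
    by (intro locc.alice[OF instrument_restrict_rows[OF A]]) (auto intro: fail)
  moreover have "L X = kraus_map (kron_mat (restrict_rows S A) (restrict_rows T B)) X"
    if X: "X \<in> carrier_mat (n * q) (n * q)" for X
  proof -
    define RA where "RA = restrict_rows S A"
    define RB where "RB = restrict_rows T B"
    have R: "RA \<in> carrier_mat m n" "RB \<in> carrier_mat p q" using A B by (auto simp: RA_def RB_def)
    then have carrier: "kron_mat RA (1\<^sub>m q) \<in> carrier_mat (m * q) (n * q)"
      "kron_mat (1\<^sub>m m) RB \<in> carrier_mat (m * p) (m * q)" by auto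
    have LB: "LB Y = kraus_map (kron_mat (1\<^sub>m m) RB) Y" if "Y \<in> carrier_mat (m * q) (m * q)" for Y
    proof -
      have "LB Y = id_tensor m q p (kraus_map RB) Y"
        unfolding LB_def EB_def RB_def
        by (intro eq_matI) (auto simp: numeral_2_eq_2 fail_def id_tensor_def)
      then show ?thesis using id_tensor_kraus_map[OF R(2) that] by simp
    qed
    have "L X = LB (tensor_id n m q (kraus_map RA) X)"
      unfolding L_def EA_def RA_def
      by (intro eq_matI) (auto simp: numeral_2_eq_2 fail_def LB_def)
    also have "\<dots> = kraus_map (kron_mat (1\<^sub>m m) RB) (kraus_map (kron_mat RA (1\<^sub>m q)) X)"
      unfolding tensor_id_kraus_map[OF R(1) X] using carrier by (intro LB) auto
    \<comment> \<open>Local operators of different nodes compose to their Kronecker product.\<close>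
    also have "\<dots> = kraus_map (kron_mat (1\<^sub>m m) RB * kron_mat RA (1\<^sub>m q)) X"
      by (rule kraus_map_mult[OF carrier(2,1) X])
    also have "kron_mat (1\<^sub>m m) RB * kron_mat RA (1\<^sub>m q) = kron_mat RA RB"
      using R by (subst kron_mat_mult[of _ m m _ p q _ n _ q]) auto
    finally show ?thesis by (simp add: RA_def RB_def)
  qed
  ultimately show ?thesis by blast
qed

lemma swap23_one: "swap23 (1\<^sub>m 16) = 1\<^sub>m 16"
proof (rule eq_matI)
  fix i j :: nat assume "i < dim_row (1\<^sub>m 16)" "j < dim_col (1\<^sub>m 16)"
  then have ij: "i < 16" "j < 16" by auto
  then have "swap23_index i = swap23_index j \<longleftrightarrow> i = j"
    by (metis swap23_index_swap23_index)
  then show "swap23 (1\<^sub>m 16) $$ (i,j) = 1\<^sub>m 16 $$ (i,j)"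
    using ij by simp
qed auto

text \<open>Exchanging the middle qubits preserves products and adjoints. Hence the exchanged
  operator inherits both the isometry property behind trace non-increase and the LOCC
  realisation.\<close>

lemma distillation_operation_kraus_map:
  assumes A: "A \<in> carrier_mat 4 4" "adjoint A * A = 1\<^sub>m 4"
    and B: "B \<in> carrier_mat 4 4" "adjoint B * B = 1\<^sub>m 4"
  shows "distillation_operation (kraus_map (swap23 (kron_mat (restrict_rows S A) (restrict_rows T B))))"
  unfolding distillation_operation_def
proof
  have AB: "kron_mat A B \<in> carrier_mat 16 16" using kron_mat_carrier[OF A(1) B(1)] by simp
  have "adjoint (swap23 (kron_mat A B)) * swap23 (kron_mat A B)
      = swap23 (adjoint (kron_mat A B) * kron_mat A B)"
    using AB by (simp add: swap23_mult swap23_adjoint)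
  also have "\<dots> = 1\<^sub>m 16"
    using isometry_kron[OF A(1) B(1) A(2) B(2)] by (simp add: swap23_one)
  finally show "quantum_operation 16 16
      (kraus_map (swap23 (kron_mat (restrict_rows S A) (restrict_rows T B))))"
    unfolding restrict_rows_kron[OF A(1) B(1)] by (intro quantum_operation_restrict_rows) auto
next
  define K where "K = kron_mat (restrict_rows S A) (restrict_rows T B)"
  have K: "K \<in> carrier_mat 16 16"
    using kron_mat_carrier[of "restrict_rows S A" 4 4 "restrict_rows T B" 4 4] A B
    by (auto simp: K_def)
  obtain L where L: "locc 4 4 4 4 L" "\<And>X. X \<in> carrier_mat 16 16 \<Longrightarrow> L X = kraus_map K X"
    using locc_restrict_rows[OF A B, of S T] by (auto simp: K_def)
  have "kraus_map (swap23 K) X = swap23 (L (swap23 X))" if X: "X \<in> carrier_mat 16 16" for X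
    using K X by (simp add: L(2) kraus_map_def swap23_mult[of _ "adjoint K"] swap23_mult[of K]
        mult_carrier_mat[of _ 16 16 _ 16] swap23_adjoint swap23_swap23)
  with L(1) show "\<exists>L. locc 4 4 4 4 L \<and> (\<forall>X\<in>carrier_mat 16 16.
      kraus_map (swap23 (kron_mat (restrict_rows S A) (restrict_rows T B))) X = swap23 (L (swap23 X)))"
    by (auto simp: K_def)
qed

text \<open>CNOT with the second qubit as control and the first as target, then a Hadamard gate on the
  second qubit.\<close>

definition cnot_hadamard :: "complex mat" where
  "cnot_hadamard = mat 4 4 (\<lambda>(i,j). complex_of_real (1 / sqrt 2) *
     (if i < 2 then (if j = 0 then 1 else if j = 3 then (-1) ^ i else 0)
      else (if j = 1 then (-1) ^ i else if j = 2 then 1 else 0)))"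

lemma cnot_hadamard_carrier [simp]: "cnot_hadamard \<in> carrier_mat 4 4"
  by (simp add: cnot_hadamard_def)

lemma less_4_cases: "(i::nat) < 4 \<Longrightarrow> i = 0 \<or> i = 1 \<or> i = 2 \<or> i = 3"
  by auto

lemma isometry_cnot_hadamard: "adjoint cnot_hadamard * cnot_hadamard = 1\<^sub>m 4"
proof (rule eq_matI)
  fix i j :: nat assume "i < dim_row (1\<^sub>m 4)" "j < dim_col (1\<^sub>m 4)"
  then have ij: "i < 4" "j < 4" by auto
  have "(adjoint cnot_hadamard * cnot_hadamard) $$ (i,j)
      = (\<Sum>x<4. cnj (cnot_hadamard $$ (x,i)) * cnot_hadamard $$ (x,j))"
    using ij by (subst index_mult_mat_sum[of _ 4 4 _ 4]) (auto simp: cnot_hadamard_def)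
  also have "\<dots> = 1\<^sub>m 4 $$ (i,j)"
    using less_4_cases[OF ij(1)] less_4_cases[OF ij(2)]
    by (elim disjE) (simp_all add: sum_lessThan_4 cnot_hadamard_def of_real_sqrt2_mult)
  finally show "(adjoint cnot_hadamard * cnot_hadamard) $$ (i,j) = 1\<^sub>m 4 $$ (i,j)" .
qed (auto simp: cnot_hadamard_def)

text \<open>The rows are the bras of \<open>c\<close> and \<open>c'\<close>, so this unitary takes
  the given basis to the computational one.\<close>

definition change_of_basis :: "complex vec \<Rightarrow> complex vec \<Rightarrow> complex mat" where
  "change_of_basis c c' = mat 2 2 (\<lambda>(i,j). cnj ((if i = 0 then c else c') $ j))"

lemma change_of_basis_carrier [simp]: "change_of_basis c c' \<in> carrier_mat 2 2"
  by (simp add: change_of_basis_def)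

lemma orthonormal_basis_C2_sums:
  assumes "orthonormal_basis_C2 c c'"
  shows "(\<Sum>x<2. cnj (c $ x) * c $ x) = 1" "(\<Sum>x<2. cnj (c' $ x) * c' $ x) = 1"
    "(\<Sum>x<2. cnj (c $ x) * c' $ x) = 0" "(\<Sum>x<2. cnj (c' $ x) * c $ x) = 0"
proof -
  have *: "u \<bullet>c v = (\<Sum>x<2. cnj (v $ x) * u $ x)" if "v \<in> carrier_vec 2" for u v :: "complex vec"
    using that by (simp add: cscalar_prod_sum mult.commute)
  show 1: "(\<Sum>x<2. cnj (c $ x) * c $ x) = 1" "(\<Sum>x<2. cnj (c' $ x) * c' $ x) = 1"
    "(\<Sum>x<2. cnj (c' $ x) * c $ x) = 0"
    using assms by (auto simp: orthonormal_basis_C2_def *)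
  show "(\<Sum>x<2. cnj (c $ x) * c' $ x) = 0"
    using arg_cong[OF 1(3), of cnj] by (simp add: mult.commute)
qed

lemma isometry_change_of_basis:
  assumes "orthonormal_basis_C2 c c'"
  shows "adjoint (change_of_basis c c') * change_of_basis c c' = 1\<^sub>m 2"
proof -
  \<comment> \<open>Orthonormality speaks about the rows. The product in the other order follows
    because a one-sided inverse of a square matrix is two-sided.\<close>
  have "change_of_basis c c' * adjoint (change_of_basis c c') = 1\<^sub>m 2"
  proof (rule eq_matI)
    fix i j :: nat assume "i < dim_row (1\<^sub>m 2)" "j < dim_col (1\<^sub>m 2)"
    then have ij: "i < 2" "j < 2" by auto
    have "(change_of_basis c c' * adjoint (change_of_basis c c')) $$ (i,j)
        = (\<Sum>x<2. change_of_basis c c' $$ (i,x) * adjoint (change_of_basis c c') $$ (x,j))"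
      using ij by (intro index_mult_mat_sum) auto
    also have "\<dots> = (\<Sum>x<2. cnj ((if i = 0 then c else c') $ x) * (if j = 0 then c else c') $ x)"
      using ij by (intro sum.cong refl) (simp add: change_of_basis_def)
    also have "\<dots> = 1\<^sub>m 2 $$ (i,j)"
      using less_2_cases[OF ij(1)] less_2_cases[OF ij(2)]
      by (elim disjE) (simp_all add: orthonormal_basis_C2_sums[OF assms])
    finally show "(change_of_basis c c' * adjoint (change_of_basis c c')) $$ (i,j) = 1\<^sub>m 2 $$ (i,j)" .
  qed (auto simp: change_of_basis_def)
  then show ?thesis
    by (rule mat_mult_left_right_inverse[OF change_of_basis_carrier adjoint_carrier[OF change_of_basis_carrier]])
qed

lemma change_of_basis_mult_vec:
  assumes "orthonormal_basis_C2 c c'"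
  shows "change_of_basis c c' *\<^sub>v c = unit_vec 2 0" "change_of_basis c c' *\<^sub>v c' = unit_vec 2 1"
proof -
  have index: "(change_of_basis c c' *\<^sub>v v) $ i = (\<Sum>x<2. cnj ((if i = 0 then c else c') $ x) * v $ x)"
    if "v \<in> carrier_vec 2" "i < 2" for v i
    unfolding index_mult_mat_vec_sum[OF change_of_basis_carrier that]
    using that by (intro sum.cong refl) (simp add: change_of_basis_def)
  have "(change_of_basis c c' *\<^sub>v c) $ i = unit_vec 2 0 $ i"
    "(change_of_basis c c' *\<^sub>v c') $ i = unit_vec 2 1 $ i" if "i < 2" for i
    using assms that less_2_cases[OF that]
    by (auto simp: orthonormal_basis_C2_def index orthonormal_basis_C2_sums[OF assms]
        simp del: index_mult_mat_vec)
  then show "change_of_basis c c' *\<^sub>v c = unit_vec 2 0" "change_of_basis c c' *\<^sub>v c' = unit_vec 2 1"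
    by (auto intro!: eq_vecI simp: change_of_basis_def simp del: index_mult_mat_vec)
qed

definition measurement :: "complex vec \<Rightarrow> complex vec \<Rightarrow> complex mat" where
  "measurement c c' = cnot_hadamard * kron_mat (change_of_basis c c') (change_of_basis c c')"

lemma measurement_carrier [simp]: "measurement c c' \<in> carrier_mat 4 4"
  unfolding measurement_def
  using kron_mat_carrier[OF change_of_basis_carrier change_of_basis_carrier, of c c' c c']
  by (intro mult_carrier_mat[of _ 4 4]) auto

lemma isometry_measurement:
  assumes "orthonormal_basis_C2 c c'"
  shows "adjoint (measurement c c') * measurement c c' = 1\<^sub>m 4"
  unfolding measurement_def
  using isometry_kron[OF change_of_basis_carrier change_of_basis_carrier
      isometry_change_of_basis[OF assms] isometry_change_of_basis[OF assms]]
    kron_mat_carrier[OF change_of_basis_carrier change_of_basis_carrier, of c c' c c']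
  by (intro isometry_mult[of _ 4 4 _ 4] isometry_cnot_hadamard) auto

lemma restrict_rows_mult_vec:
  assumes "A \<in> carrier_mat n m" "v \<in> carrier_vec m"
  shows "restrict_rows S A *\<^sub>v v = vec n (\<lambda>i. if i \<in> S then (A *\<^sub>v v) $ i else 0)"
  using assms
  by (intro eq_vecI) (auto simp: scalar_prod_def restrict_rows_def)

text \<open>The kept qubit receives the parity of the two labels. Finding the measured qubit in |0>
  erases which of the two strings of that parity was present, and introduces no sign.\<close>

lemma measurement_mult_vec:
  assumes "orthonormal_basis_C2 c c'"
  shows
    "restrict_rows {0,2} (measurement c c') *\<^sub>v kron_vec c c = complex_of_real (1 / sqrt 2) \<cdot>\<^sub>v unit_vec 4 0"
    "restrict_rows {0,2} (measurement c c') *\<^sub>v kron_vec c' c' = complex_of_real (1 / sqrt 2) \<cdot>\<^sub>v unit_vec 4 0"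
    "restrict_rows {0,2} (measurement c c') *\<^sub>v kron_vec c c' = complex_of_real (1 / sqrt 2) \<cdot>\<^sub>v unit_vec 4 2"
    "restrict_rows {0,2} (measurement c c') *\<^sub>v kron_vec c' c = complex_of_real (1 / sqrt 2) \<cdot>\<^sub>v unit_vec 4 2"
proof -
  have c: "c \<in> carrier_vec 2" "c' \<in> carrier_vec 2"
    using assms by (auto simp: orthonormal_basis_C2_def)
  have meas: "restrict_rows {0,2} (measurement c c') *\<^sub>v kron_vec x y
      = vec 4 (\<lambda>i. if i \<in> {0,2} then (cnot_hadamard *\<^sub>v
          kron_vec (change_of_basis c c' *\<^sub>v x) (change_of_basis c c' *\<^sub>v y)) $ i else 0)"
    if "x \<in> carrier_vec 2" "y \<in> carrier_vec 2" for x y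
  proof -
    have "measurement c c' *\<^sub>v kron_vec x y
        = cnot_hadamard *\<^sub>v (kron_mat (change_of_basis c c') (change_of_basis c c') *\<^sub>v kron_vec x y)"
      unfolding measurement_def
      using kron_mat_carrier[OF change_of_basis_carrier change_of_basis_carrier, of c c' c c']
        kron_vec_carrier[OF that]
      by (intro assoc_mult_mat_vec[of _ 4 4 _ 4]) auto
    also have "\<dots> = cnot_hadamard *\<^sub>v
        kron_vec (change_of_basis c c' *\<^sub>v x) (change_of_basis c c' *\<^sub>v y)"
      using that by (subst kron_mat_mult_vec[of _ 2 2 _ 2 2]) auto
    finally have eq: "measurement c c' *\<^sub>v kron_vec x y = cnot_hadamard *\<^sub>v
        kron_vec (change_of_basis c c' *\<^sub>v x) (change_of_basis c c' *\<^sub>v y)" .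
    have "kron_vec x y \<in> carrier_vec 4" using kron_vec_carrier[OF that] by simp
    from restrict_rows_mult_vec[OF measurement_carrier[of c c'] this, of "{0,2}"] show ?thesis
      unfolding eq by blast
  qed
  have had: "vec 4 (\<lambda>i. if i \<in> {0,2} then (cnot_hadamard *\<^sub>v
      kron_vec (unit_vec 2 x) (unit_vec 2 y)) $ i else 0)
      = complex_of_real (1 / sqrt 2) \<cdot>\<^sub>v unit_vec 4 (if x = y then 0 else 2)" 
    if xy: "x \<in> {0,1}" "y \<in> {0,1}" for x y
  proof (rule eq_vecI)
    fix i assume "i < dim_vec (complex_of_real (1 / sqrt 2) \<cdot>\<^sub>v unit_vec 4 (if x = y then 0 else 2))"
    then have i: "i < 4" by simp
    have kc: "kron_vec (unit_vec 2 x) (unit_vec 2 y) \<in> carrier_vec 4"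
      using kron_vec_carrier[of "unit_vec 2 x" 2 "unit_vec 2 y" 2] by simp
    have "(cnot_hadamard *\<^sub>v kron_vec (unit_vec 2 x) (unit_vec 2 y)) $ i
        = (\<Sum>k<4. cnot_hadamard $$ (i,k) * kron_vec (unit_vec 2 x) (unit_vec 2 y) $ k)"
      using i kc by (intro index_mult_mat_vec_sum) auto
    then show "vec 4 (\<lambda>i. if i \<in> {0,2} then (cnot_hadamard *\<^sub>v
      kron_vec (unit_vec 2 x) (unit_vec 2 y)) $ i else 0) $ i
      = (complex_of_real (1 / sqrt 2) \<cdot>\<^sub>v unit_vec 4 (if x = y then 0 else 2)) $ i"
      using xy less_4_cases[OF i]
      by (auto simp: sum_lessThan_4 cnot_hadamard_def simp del: index_mult_mat_vec)
  qed simp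
  show "restrict_rows {0,2} (measurement c c') *\<^sub>v kron_vec c c = complex_of_real (1 / sqrt 2) \<cdot>\<^sub>v unit_vec 4 0"
    "restrict_rows {0,2} (measurement c c') *\<^sub>v kron_vec c' c' = complex_of_real (1 / sqrt 2) \<cdot>\<^sub>v unit_vec 4 0"
    "restrict_rows {0,2} (measurement c c') *\<^sub>v kron_vec c c' = complex_of_real (1 / sqrt 2) \<cdot>\<^sub>v unit_vec 4 2"
    "restrict_rows {0,2} (measurement c c') *\<^sub>v kron_vec c' c = complex_of_real (1 / sqrt 2) \<cdot>\<^sub>v unit_vec 4 2"
    unfolding meas[OF c(1) c(1)] meas[OF c(2) c(2)] meas[OF c(1) c(2)] meas[OF c(2) c(1)]
      change_of_basis_mult_vec[OF assms]
    using had[of 0 0] had[of 1 1] had[of 0 1] had[of 1 0] by auto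
qed

section \<open>The given states as mixtures of two Bell-like vectors\<close>

text \<open>The signs 1 and -1 give v and w. Keeping the sign as a parameter lets one computation
  treat all four products of two such vectors.\<close>

definition cat_state ::
  "complex \<Rightarrow> complex vec \<Rightarrow> complex vec \<Rightarrow> complex vec \<Rightarrow> complex vec \<Rightarrow> complex vec" where
  "cat_state s a a' b b' = complex_of_real (1 / sqrt 2) \<cdot>\<^sub>v (kron_vec a b + s \<cdot>\<^sub>v kron_vec a' b')"

lemma cat_state_carrier [simp]:
  assumes "a \<in> carrier_vec 2" "a' \<in> carrier_vec 2" "b \<in> carrier_vec 2" "b' \<in> carrier_vec 2"
  shows "cat_state s a a' b b' \<in> carrier_vec 4"
  using kron_vec_carrier[OF assms(1,3)] kron_vec_carrier[OF assms(2,4)]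
  by (auto simp: cat_state_def)

lemma orthonormal_basis_C2_rephase:
  assumes "orthonormal_basis_C2 a a'" "u * cnj u = 1"
  shows "orthonormal_basis_C2 a (u \<cdot>\<^sub>v a')"
proof -
  have a: "a \<in> carrier_vec 2" "a' \<in> carrier_vec 2"
    using assms by (auto simp: orthonormal_basis_C2_def)
  have "(u \<cdot>\<^sub>v a') \<bullet>c (u \<cdot>\<^sub>v a') = (u * cnj u) * (a' \<bullet>c a')" "a \<bullet>c (u \<cdot>\<^sub>v a') = cnj u * (a \<bullet>c a')"
    using a by (simp_all add: cscalar_prod_sum[of _ 2] sum_distrib_left mult_ac)
  then show ?thesis using assms a by (auto simp: orthonormal_basis_C2_def)
qed

text \<open>The two weights add up to 1 on the diagonal terms, which do not feel the phase
  \<open>u\<close>, and their difference \<open>2 * F - 1\<close> is left on the coherences, where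
  \<open>u\<close> supplies the phase.\<close>

lemma S_state_eq_mixture:
  fixes F :: real
  assumes c: "a \<in> carrier_vec 2" "a' \<in> carrier_vec 2" "b \<in> carrier_vec 2" "b' \<in> carrier_vec 2"
    and u: "u * cnj u = 1" and R: "exp (\<i> * complex_of_real \<alpha>) * R = complex_of_real (2 * F - 1) * u"
  shows "S_state a a' b b' \<alpha> R =
    complex_of_real F \<cdot>\<^sub>m ketbra (cat_state 1 a (u \<cdot>\<^sub>v a') b b') (cat_state 1 a (u \<cdot>\<^sub>v a') b b') +
    complex_of_real (1 - F) \<cdot>\<^sub>m ketbra (cat_state (-1) a (u \<cdot>\<^sub>v a') b b') (cat_state (-1) a (u \<cdot>\<^sub>v a') b b')"
    (is "_ = ?R")
proof (rule eq_matI)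
  have dims: "dim_vec a = 2" "dim_vec a' = 2" "dim_vec b = 2" "dim_vec b' = 2" using c by auto
  have "cnj (exp (\<i> * complex_of_real \<alpha>)) = exp (- \<i> * complex_of_real \<alpha>)"
    using cis_cnj[of \<alpha>] by (simp add: cis_conv_exp)
  then have R': "exp (- \<i> * complex_of_real \<alpha>) * cnj R = complex_of_real (2 * F - 1) * cnj u"
    using arg_cong[OF R, of cnj] by simp
  define x where "x = kron_vec a b"
  define y where "y = kron_vec a' b'"
  have xy: "x \<in> carrier_vec 4" "y \<in> carrier_vec 4"
    using kron_vec_carrier[OF c(1,3)] kron_vec_carrier[OF c(2,4)] by (auto simp: x_def y_def)
  have ux: "kron_vec (u \<cdot>\<^sub>v a') b' = u \<cdot>\<^sub>v y"
    unfolding y_def by (intro eq_vecI) (auto simp: dims)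
  fix i j assume "i < dim_row ?R" "j < dim_col ?R"
  then have ij: "i < 4" "j < 4" by (auto simp: cat_state_def dims)
  have cat: "cat_state s a (u \<cdot>\<^sub>v a') b b' $ k = complex_of_real (1 / sqrt 2) * (x $ k + s * (u * y $ k))"
    "dim_vec (cat_state s a (u \<cdot>\<^sub>v a') b b') = 4" if "k < 4" for s k
    using that xy by (simp_all add: cat_state_def ux flip: x_def)
  have half: "complex_of_real (1 / sqrt 2) * complex_of_real (1 / sqrt 2) = 1 / 2"
    by (simp add: of_real_sqrt2_mult)
  have kb: "ketbra (cat_state s a (u \<cdot>\<^sub>v a') b b') (cat_state s a (u \<cdot>\<^sub>v a') b b') $$ (i,j)
      = (x $ i + s * (u * y $ i)) * cnj (x $ j + s * (u * y $ j)) / 2" for s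
  proof -
    have "ketbra (cat_state s a (u \<cdot>\<^sub>v a') b b') (cat_state s a (u \<cdot>\<^sub>v a') b b') $$ (i,j)
      = (complex_of_real (1 / sqrt 2) * complex_of_real (1 / sqrt 2)) *
        ((x $ i + s * (u * y $ i)) * cnj (x $ j + s * (u * y $ j)))"
      using ij by (simp only: index_ketbra cat complex_cnj_mult complex_cnj_complex_of_real mult_ac)
    then show ?thesis unfolding half by simp
  qed
  have "S_state a a' b b' \<alpha> R $$ (i,j) = (1/2) * (x $ i * cnj (x $ j)
      + (complex_of_real (2 * F - 1) * cnj u) * (x $ i * cnj (y $ j))
      + (complex_of_real (2 * F - 1) * u) * (y $ i * cnj (x $ j)) + (u * cnj u) * (y $ i * cnj (y $ j)))"
    unfolding S_state_def R R' u x_def[symmetric] y_def[symmetric] using xy ij by simp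
  also have "\<dots> = complex_of_real F * ((x $ i + 1 * (u * y $ i)) * cnj (x $ j + 1 * (u * y $ j)) / 2)
      + complex_of_real (1 - F) * ((x $ i + (-1) * (u * y $ i)) * cnj (x $ j + (-1) * (u * y $ j)) / 2)"
    by (simp add: field_simps)
  also have "\<dots> = ?R $$ (i,j)"
    unfolding kb[symmetric] using ij cat(2)[of 0] by simp
  finally show "S_state a a' b b' \<alpha> R $$ (i,j) = ?R $$ (i,j)" .
qed (use c in \<open>auto simp: S_state_def cat_state_def\<close>)

text \<open>The coherences of the two projectors are opposite and cancel, leaving a sum of products
  between Alice and Bob.\<close>

lemma cat_state_projectors:
  assumes c: "a \<in> carrier_vec 2" "a' \<in> carrier_vec 2" "b \<in> carrier_vec 2" "b' \<in> carrier_vec 2"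
  shows "ketbra (cat_state 1 a a' b b') (cat_state 1 a a' b b')
      + ketbra (cat_state (-1) a a' b b') (cat_state (-1) a a' b b')
    = kron_mat (ketbra a a) (ketbra b b) + kron_mat (ketbra a' a') (ketbra b' b')"
    (is "?L = ?R")
  unfolding kron_mat_ketbra
proof (rule eq_matI)
  define x where "x = kron_vec a b"
  define y where "y = kron_vec a' b'"
  have xy: "x \<in> carrier_vec 4" "y \<in> carrier_vec 4"
    using kron_vec_carrier[OF c(1,3)] kron_vec_carrier[OF c(2,4)] by (auto simp: x_def y_def)
  fix i j
  assume "i < dim_row (ketbra (kron_vec a b) (kron_vec a b) + ketbra (kron_vec a' b') (kron_vec a' b'))"
    "j < dim_col (ketbra (kron_vec a b) (kron_vec a b) + ketbra (kron_vec a' b') (kron_vec a' b'))"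
  then have ij: "i < 4" "j < 4" using c by auto
  have "?L $$ (i,j) = ((x $ i + y $ i) * cnj (x $ j + y $ j) + (x $ i - y $ i) * cnj (x $ j - y $ j)) / 2"
    using ij xy by (simp add: cat_state_def of_real_sqrt2_mult flip: x_def y_def)
  also have "\<dots> = x $ i * cnj (x $ j) + y $ i * cnj (y $ j)"
    by (simp add: field_simps)
  finally show "?L $$ (i,j)
      = (ketbra (kron_vec a b) (kron_vec a b) + ketbra (kron_vec a' b') (kron_vec a' b')) $$ (i,j)"
    using ij xy by (simp flip: x_def y_def)
qed (use c in \<open>auto simp: cat_state_def\<close>)

text \<open>Expanding gives four products of rank-one matrices on single qubits, and the exchange
  regroups each of them into a factor of Alice and a factor of Bob.\<close>

lemma separable_swap23_classical:
  assumes c: "a \<in> carrier_vec 2" "a' \<in> carrier_vec 2" "b \<in> carrier_vec 2" "b' \<in> carrier_vec 2"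
  defines "\<sigma> \<equiv> kron_mat (ketbra a a) (ketbra b b) + kron_mat (ketbra a' a') (ketbra b' b')"
  shows "separable 4 4 (swap23 (kron_mat \<sigma> \<sigma>))"
proof -
  define P where "P = kron_mat (ketbra a a) (ketbra b b)"
  define M where "M = kron_mat (ketbra a' a') (ketbra b' b')"
  have PM: "P \<in> carrier_mat 4 4" "M \<in> carrier_mat 4 4"
    using c kron_mat_carrier[of _ 2 2 _ 2 2] by (auto simp: P_def M_def)
  have c16: "kron_mat P P \<in> carrier_mat 16 16" "kron_mat P M \<in> carrier_mat 16 16"
    "kron_mat M P \<in> carrier_mat 16 16" "kron_mat M M \<in> carrier_mat 16 16"
    using PM kron_mat_carrier[of _ 4 4 _ 4 4] by auto
  have "1 \<cdot>\<^sub>m A = A" for A :: "complex mat" by (intro eq_matI) auto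
  then have "kron_mat \<sigma> \<sigma> = kron_mat P P + (kron_mat P M + kron_mat M P) + kron_mat M M"
    using kron_mat_lincomb[OF PM, of 1 1] by (simp add: \<sigma>_def P_def M_def)
  then have "swap23 (kron_mat \<sigma> \<sigma>) = swap23 (kron_mat P P)
      + (swap23 (kron_mat P M) + swap23 (kron_mat M P)) + swap23 (kron_mat M M)"
    using c16 by (simp add: swap23_add assoc_add_mat[of _ 16 16])
  moreover have "separable 4 4 (swap23 (kron_mat
      (kron_mat (ketbra x x) (ketbra y y)) (kron_mat (ketbra x' x') (ketbra y' y'))))"
    if "x \<in> carrier_vec 2" "x' \<in> carrier_vec 2" "y \<in> carrier_vec 2" "y' \<in> carrier_vec 2" for x x' y y'
    using that psd_ketbra[OF kron_vec_carrier[of _ 2 _ 2]]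
    by (subst swap23_kron) (auto simp: kron_mat_ketbra[of x x x'] kron_mat_ketbra[of y y y']
        intro!: separable_kron)
  ultimately show ?thesis
    unfolding P_def M_def using c by (simp add: separable_add)
qed

section \<open>The success branch on two copies\<close>

text \<open>The vector x |0000> + y |1100>: the kept pair holds equal bits and the measured qubits
  are in |00>.\<close>

definition pair_vec :: "complex \<Rightarrow> complex \<Rightarrow> complex vec" where
  "pair_vec x y = vec 16 (\<lambda>i. if i = 0 then x else if i = 12 then y else 0)"

lemma pair_vec_carrier [simp]: "pair_vec x y \<in> carrier_vec 16"
  by (simp add: pair_vec_def)

lemma trace_ketbra_pair_vec: "trace_mat (ketbra (pair_vec x y) (pair_vec x y)) = x * cnj x + y * cnj y"
proof -
  have "trace_mat (ketbra (pair_vec x y) (pair_vec x y))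
      = (\<Sum>i<16. if i \<in> {0,12} then pair_vec x y $ i * cnj (pair_vec x y $ i) else 0)"
    unfolding trace_mat_def by (intro sum.cong) (auto simp: pair_vec_def)
  also have "\<dots> = (\<Sum>i\<in>{0,12}. pair_vec x y $ i * cnj (pair_vec x y $ i))"
    by (subst sum.inter_restrict[symmetric]) (auto intro: sum.cong)
  finally show ?thesis by (simp add: pair_vec_def)
qed

lemma bell_weight_ketbra_pair_vec:
  "bell_weight (ketbra (pair_vec x y) (pair_vec x y)) = (x + y) * cnj (x + y) / 2"
  by (simp add: bell_weight_def sum_lessThan_4 pair_vec_def algebra_simps)

lemma swap23_mult_vec:
  assumes A: "A \<in> carrier_mat 16 16" and v: "v \<in> carrier_vec 16" and i: "i < 16"
  shows "(swap23 A *\<^sub>v v) $ i = (A *\<^sub>v vec 16 (\<lambda>x. v $ swap23_index x)) $ swap23_index i"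
proof -
  have "(swap23 A *\<^sub>v v) $ i = (\<Sum>x<16. swap23 A $$ (i,x) * v $ x)"
    using v i by (intro index_mult_mat_vec_sum) auto
  also have "\<dots> = (\<Sum>x<16. A $$ (swap23_index i,x) * v $ swap23_index x)"
    using i by (subst sum_swap23_index[symmetric]) (intro sum.cong, auto)
  also have "\<dots> = (\<Sum>x<16. A $$ (swap23_index i,x) * vec 16 (\<lambda>x. v $ swap23_index x) $ x)"
    by simp
  also have "\<dots> = (A *\<^sub>v vec 16 (\<lambda>x. v $ swap23_index x)) $ swap23_index i"
    using A i by (intro index_mult_mat_vec_sum[symmetric]) auto
  finally show ?thesis .
qed

lemma swap23_kron_vec:
  assumes "a \<in> carrier_vec 2" "b \<in> carrier_vec 2" "c \<in> carrier_vec 2" "d \<in> carrier_vec 2"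
  shows "vec 16 (\<lambda>x. kron_vec (kron_vec a b) (kron_vec c d) $ swap23_index x)
    = kron_vec (kron_vec a c) (kron_vec b d)"
proof (rule eq_vecI)
  have index: "kron_vec (kron_vec a b) (kron_vec c d) $ i =
      a $ (i div 4 div 2) * b $ (i div 4 mod 2) * (c $ (i mod 4 div 2) * d $ (i mod 4 mod 2))"
    if "i < 16" "a \<in> carrier_vec 2" "b \<in> carrier_vec 2" "c \<in> carrier_vec 2" "d \<in> carrier_vec 2"
    for i and a b c d :: "complex vec"
    using that by (auto simp: kron_vec_def)
  fix i assume "i < dim_vec (kron_vec (kron_vec a c) (kron_vec b d))"
  then have i: "i < 16" using assms by simp
  show "vec 16 (\<lambda>x. kron_vec (kron_vec a b) (kron_vec c d) $ swap23_index x) $ i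
    = kron_vec (kron_vec a c) (kron_vec b d) $ i"
    unfolding index[OF i assms(1,3,2,4)] using i
    by (simp add: index[OF swap23_index_less[OF i] assms] swap23_index_qubits mult_ac)
qed (use assms in auto)

text \<open>The rows 0 and 2 are those in which the second qubit of a node is found in \<open>|0\<rangle>\<close>.\<close>

definition success_kraus :: "complex vec \<Rightarrow> complex vec \<Rightarrow> complex vec \<Rightarrow> complex vec \<Rightarrow> complex mat" where
  "success_kraus a a' b b' = swap23 (kron_mat
     (restrict_rows {0,2} (measurement a a')) (restrict_rows {0,2} (measurement b b')))"

lemma success_kraus_carrier [simp]: "success_kraus a a' b b' \<in> carrier_mat 16 16"
  by (simp add: success_kraus_def)

lemma success_kraus_kron_vec:
  assumes "x \<in> carrier_vec 2" "y \<in> carrier_vec 2" "x' \<in> carrier_vec 2" "y' \<in> carrier_vec 2" and i: "i < 16"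
  shows "(success_kraus a a' b b' *\<^sub>v kron_vec (kron_vec x y) (kron_vec x' y')) $ i
    = kron_vec (restrict_rows {0,2} (measurement a a') *\<^sub>v kron_vec x x')
        (restrict_rows {0,2} (measurement b b') *\<^sub>v kron_vec y y') $ swap23_index i"
proof -
  have R: "restrict_rows {0,2} (measurement c c') \<in> carrier_mat 4 4" for c c'
    by (simp add: restrict_rows_carrier)
  have k4: "kron_vec v w \<in> carrier_vec 4" if "v \<in> carrier_vec 2" "w \<in> carrier_vec 2" for v w
    using kron_vec_carrier[OF that] by simp
  have k16: "kron_vec (kron_vec x y) (kron_vec x' y') \<in> carrier_vec 16"
    using kron_vec_carrier[OF k4[OF assms(1,2)] k4[OF assms(3,4)]] by simp
  show ?thesis
    unfolding success_kraus_def
    using kron_mat_carrier[OF R R, of a a' b b']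
    by (subst swap23_mult_vec[OF _ k16 i], simp, subst swap23_kron_vec[OF assms(1-4)],
        subst kron_mat_mult_vec[OF R R k4[OF assms(1,3)] k4[OF assms(2,4)]]) simp
qed

text \<open>In node order equal parities sit at the indices 0 and 10 = 4 * 2 + 2; the exchange moves
  10, which is 1010 in binary, to 12.\<close>

lemma kron_unit_vec_swap23:
  assumes "i < 16" "x \<in> {0,2}"
  shows "kron_vec (complex_of_real (1 / sqrt 2) \<cdot>\<^sub>v unit_vec 4 x)
      (complex_of_real (1 / sqrt 2) \<cdot>\<^sub>v unit_vec 4 x) $ swap23_index i
    = (if x = 0 then pair_vec (1/2) 0 else pair_vec 0 (1/2)) $ i"
  by (rule less_16_cases[OF assms(1)];
      use assms(2) in \<open>auto simp: swap23_index_def pair_vec_def of_real_sqrt2_mult\<close>)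

text \<open>Both nodes see the same parity in each of the four terms, so equal terms end in |00> and
  unequal ones in |11>. For opposite signs \<open>s\<close> and \<open>t\<close> both amplitudes
  cancel; for equal signs the result is proportional to Phi+ or Phi-.\<close>

lemma success_kraus_cat_state:
  assumes a: "orthonormal_basis_C2 a a'" and b: "orthonormal_basis_C2 b b'"
  shows "success_kraus a a' b b' *\<^sub>v kron_vec (cat_state s a a' b b') (cat_state t a a' b b')
    = pair_vec ((1 + s * t) / 4) ((s + t) / 4)"
proof (rule eq_vecI)
  have c: "a \<in> carrier_vec 2" "a' \<in> carrier_vec 2" "b \<in> carrier_vec 2" "b' \<in> carrier_vec 2"
    using a b by (auto simp: orthonormal_basis_C2_def)
  let ?K = "success_kraus a a' b b'"
  define x where "x = kron_vec a b"
  define y where "y = kron_vec a' b'"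
  have xy: "x \<in> carrier_vec 4" "y \<in> carrier_vec 4"
    using kron_vec_carrier[OF c(1,3)] kron_vec_carrier[OF c(2,4)] by (auto simp: x_def y_def)
  have k16: "kron_vec v w \<in> carrier_vec 16" if "v \<in> carrier_vec 4" "w \<in> carrier_vec 4" for v w
    using kron_vec_carrier[OF that] by simp
  have expand: "kron_vec (cat_state s a a' b b') (cat_state t a a' b b') $ k
      = (kron_vec x x $ k + t * kron_vec x y $ k + s * kron_vec y x $ k + s * t * kron_vec y y $ k) / 2"
    if "k < 16" for k
  proof -
    have "kron_vec (cat_state s a a' b b') (cat_state t a a' b b') $ k
      = (complex_of_real (1 / sqrt 2) * complex_of_real (1 / sqrt 2)) *
        (kron_vec x x $ k + t * kron_vec x y $ k + s * kron_vec y x $ k + s * t * kron_vec y y $ k)"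
      using that xy by (simp add: cat_state_def algebra_simps flip: x_def y_def)
    then show ?thesis by (simp add: of_real_sqrt2_mult)
  qed
  fix i assume "i < dim_vec (pair_vec ((1 + s * t) / 4) ((s + t) / 4))"
  then have i: "i < 16" by (simp add: pair_vec_def)
  have K: "(?K *\<^sub>v v) $ i = (\<Sum>k<16. ?K $$ (i,k) * v $ k)" if "v \<in> carrier_vec 16" for v
    using that i by (intro index_mult_mat_vec_sum) auto
  have cat16: "kron_vec (cat_state s a a' b b') (cat_state t a a' b b') \<in> carrier_vec 16"
    using c by (intro k16) auto
  have "(?K *\<^sub>v kron_vec (cat_state s a a' b b') (cat_state t a a' b b')) $ i
      = ((?K *\<^sub>v kron_vec x x) $ i + t * (?K *\<^sub>v kron_vec x y) $ i
        + s * (?K *\<^sub>v kron_vec y x) $ i + s * t * (?K *\<^sub>v kron_vec y y) $ i) / 2"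
    unfolding K[OF cat16] K[OF k16[OF xy(1,1)]] K[OF k16[OF xy(1,2)]] K[OF k16[OF xy(2,1)]] K[OF k16[OF xy(2,2)]]
    by (simp only: sum_distrib_left sum_divide_distrib flip: sum.distrib)
      (intro sum.cong refl, simp only: lessThan_iff expand, simp add: field_simps)
  also have "\<dots> = pair_vec ((1 + s * t) / 4) ((s + t) / 4) $ i"
    unfolding x_def y_def success_kraus_kron_vec[OF c(1,3,1,3) i] success_kraus_kron_vec[OF c(1,3,2,4) i]
      success_kraus_kron_vec[OF c(2,4,1,3) i] success_kraus_kron_vec[OF c(2,4,2,4) i]
      measurement_mult_vec[OF a] measurement_mult_vec[OF b]
    using kron_unit_vec_swap23[OF i, of 0] kron_unit_vec_swap23[OF i, of 2] i
    by (simp add: pair_vec_def field_simps del: index_kron_vec)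
  finally show "(?K *\<^sub>v kron_vec (cat_state s a a' b b') (cat_state t a a' b b')) $ i
      = pair_vec ((1 + s * t) / 4) ((s + t) / 4) $ i" .
qed (simp add: pair_vec_def success_kraus_def)

text \<open>The two surviving components keep half of their weight each, and only the one with
  weight F^2 ends in Phi+.\<close>

lemma kept_fidelity_success_kraus:
  fixes F :: real
  assumes a: "orthonormal_basis_C2 a a'" and b: "orthonormal_basis_C2 b b'"
    and \<rho>: "\<rho> = complex_of_real F \<cdot>\<^sub>m ketbra (cat_state 1 a a' b b') (cat_state 1 a a' b b')
      + complex_of_real (1 - F) \<cdot>\<^sub>m ketbra (cat_state (-1) a a' b b') (cat_state (-1) a a' b b')"
  shows "success_prob (kraus_map (success_kraus a a' b b')) \<rho> = complex_of_real ((F\<^sup>2 + (1 - F)\<^sup>2) / 2)"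
    and "kept_fidelity (kraus_map (success_kraus a a' b b')) \<rho> = F\<^sup>2 / (F\<^sup>2 + (1 - F)\<^sup>2)"
proof -
  define P where "P = ketbra (cat_state 1 a a' b b') (cat_state 1 a a' b b')"
  define M where "M = ketbra (cat_state (-1) a a' b b') (cat_state (-1) a a' b b')"
  define D where "D = kraus_map (success_kraus a a' b b')"
  define Q where "Q x y = ketbra (pair_vec x y) (pair_vec x y)" for x y
  have c: "a \<in> carrier_vec 2" "a' \<in> carrier_vec 2" "b \<in> carrier_vec 2" "b' \<in> carrier_vec 2"
    using a b by (auto simp: orthonormal_basis_C2_def)
  have cat: "cat_state s a a' b b' \<in> carrier_vec 4" for s using c by simp
  have PM: "P \<in> carrier_mat 4 4" "M \<in> carrier_mat 4 4" using cat by (auto simp: P_def M_def)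
  have c16: "kron_mat P P \<in> carrier_mat 16 16" "kron_mat P M \<in> carrier_mat 16 16"
    "kron_mat M P \<in> carrier_mat 16 16" "kron_mat M M \<in> carrier_mat 16 16"
    using PM kron_mat_carrier[of _ 4 4 _ 4 4] by auto
  have Qc: "Q x y \<in> carrier_mat 16 16" for x y by (auto simp: Q_def)
  have "kraus_map (success_kraus a a' b b') (kron_mat
      (ketbra (cat_state s a a' b b') (cat_state s a a' b b'))
      (ketbra (cat_state t a a' b b') (cat_state t a a' b b')))
      = Q ((1 + s * t) / 4) ((s + t) / 4)" for s t
    using kron_vec_carrier[OF cat cat, of s t]
    by (simp add: kron_mat_ketbra kraus_map_ketbra[of _ 16 16] success_kraus_cat_state[OF a b] Q_def)
  then have DQ: "D (kron_mat P P) = Q (1/2) (1/2)" "D (kron_mat P M) = Q 0 0"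
    "D (kron_mat M P) = Q 0 0" "D (kron_mat M M) = Q (1/2) (-1/2)"
    unfolding D_def P_def M_def by simp_all
  have lin: "linear_mat_map 16 16 D" unfolding D_def by (rule linear_kraus_map) simp
  have Dexp: "D (kron_mat \<rho> \<rho>) = (complex_of_real F)\<^sup>2 \<cdot>\<^sub>m Q (1/2) (1/2)
      + (complex_of_real F * complex_of_real (1 - F)) \<cdot>\<^sub>m (Q 0 0 + Q 0 0)
      + (complex_of_real (1 - F))\<^sup>2 \<cdot>\<^sub>m Q (1/2) (-1/2)"
    unfolding \<rho> P_def[symmetric] M_def[symmetric] kron_mat_lincomb[OF PM]
    using lin c16 by (simp add: linear_mat_map_def DQ)
  have Dc: "D (kron_mat \<rho> \<rho>) \<in> carrier_mat 16 16" using Qc by (simp add: Dexp)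
  have "trace_mat (D (kron_mat \<rho> \<rho>)) = complex_of_real ((F\<^sup>2 + (1 - F)\<^sup>2) / 2)"
    unfolding Dexp using Qc
    by (simp add: trace_mat_add[of _ 16] trace_mat_smult[of _ 16] trace_ketbra_pair_vec Q_def
        del: of_real_diff)
  then show prob: "success_prob (kraus_map (success_kraus a a' b b')) \<rho>
      = complex_of_real ((F\<^sup>2 + (1 - F)\<^sup>2) / 2)"
    by (simp add: success_prob_def D_def)
  have weight: "bell_weight (D (kron_mat \<rho> \<rho>)) = complex_of_real (F\<^sup>2 / 2)"
    unfolding Dexp using Qc
    by (simp add: bell_weight_add bell_weight_smult bell_weight_ketbra_pair_vec Q_def)
  have "kept_fidelity D \<rho> = Re (complex_of_real (F\<^sup>2 / 2) / complex_of_real ((F\<^sup>2 + (1 - F)\<^sup>2) / 2))"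
    unfolding kept_fidelity_eq[of D \<rho>, OF Dc] weight prob[folded D_def] ..
  also have "\<dots> = F\<^sup>2 / (F\<^sup>2 + (1 - F)\<^sup>2)"
    by (simp del: of_real_divide of_real_power of_real_add flip: of_real_divide)
  finally show "kept_fidelity (kraus_map (success_kraus a a' b b')) \<rho> = F\<^sup>2 / (F\<^sup>2 + (1 - F)\<^sup>2)"
    by (simp add: D_def)
qed

theorem theorem1:
  fixes \<rho> :: "complex mat" and a a' b b' :: "complex vec" and \<alpha> F :: real and R :: complex
  assumes "density_matrix 4 \<rho>"
    and "orthonormal_basis_C2 a a'" and "orthonormal_basis_C2 b b'"
    and "0 \<le> \<alpha>" and "\<alpha> < 2 * pi"
    and "cmod R \<le> 1"
    and "\<rho> = S_state a a' b b' \<alpha> R"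
    and "F = (1 + cmod R) / 2"
  shows "is_optimal_fidelity \<rho> (F\<^sup>2 / (F\<^sup>2 + (1 - F)\<^sup>2))"
proof -
  \<comment> \<open>The phase of the coherence. At \<open>R = 0\<close> there is none and any unit
    number would do.\<close>
  define u where "u = (if R = 0 then 1 else exp (\<i> * complex_of_real \<alpha>) * R / complex_of_real (cmod R))"
  have "cmod u = 1" by (simp add: u_def norm_mult norm_divide)
  then have u: "u * cnj u = 1" by (simp flip: complex_norm_square)
  have R: "exp (\<i> * complex_of_real \<alpha>) * R = complex_of_real (2 * F - 1) * u"
  proof -
    have "2 * F - 1 = cmod R" using assms(8) by simp
    then show ?thesis by (simp add: u_def del: of_real_diff)
  qed
  \<comment> \<open>Alice's rephased basis serves twice: it puts the state into the form of a
    mixture, and it is the basis in which she performs her gates.\<close>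
  define a2 where "a2 = u \<cdot>\<^sub>v a'"
  have a2: "orthonormal_basis_C2 a a2"
    unfolding a2_def by (rule orthonormal_basis_C2_rephase[OF assms(2) u])
  have c: "a \<in> carrier_vec 2" "a' \<in> carrier_vec 2" "a2 \<in> carrier_vec 2" "b \<in> carrier_vec 2" "b' \<in> carrier_vec 2"
    using assms(2,3) a2 by (auto simp: orthonormal_basis_C2_def)
  have F: "1 / 2 \<le> F" "F \<le> 1" using assms(6,8) by auto
  let ?v = "\<lambda>s. cat_state s a a2 b b'"
  have \<rho>: "\<rho> = complex_of_real F \<cdot>\<^sub>m ketbra (?v 1) (?v 1) + complex_of_real (1 - F) \<cdot>\<^sub>m ketbra (?v (-1)) (?v (-1))"
    unfolding assms(7) a2_def by (rule S_state_eq_mixture[OF c(1,2,4,5) u R])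
  have sep: "separable 4 4 (swap23 (kron_mat (ketbra (?v 1) (?v 1) + ketbra (?v (-1)) (?v (-1)))
      (ketbra (?v 1) (?v 1) + ketbra (?v (-1)) (?v (-1)))))"
    unfolding cat_state_projectors[OF c(1,3,4,5)] by (rule separable_swap23_classical[OF c(1,3,4,5)])
  have "kept_fidelity D \<rho> \<le> F\<^sup>2 / (F\<^sup>2 + (1 - F)\<^sup>2)"
    if "distillation_operation D" "success_prob D \<rho> \<noteq> 0" for D
    by (rule kept_fidelity_le[OF that _ _ \<rho> F sep]) (use c in auto)
  moreover have "distillation_operation (kraus_map (success_kraus a a2 b b'))"
    unfolding success_kraus_def
    using isometry_measurement[OF a2] isometry_measurement[OF assms(3)]
    by (intro distillation_operation_kraus_map) auto
  moreover have "0 < F\<^sup>2 + (1 - F)\<^sup>2" using F by (intro add_pos_nonneg) auto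
  then have "success_prob (kraus_map (success_kraus a a2 b b')) \<rho> \<noteq> 0"
    unfolding kept_fidelity_success_kraus(1)[OF a2 assms(3) \<rho>] by (simp only: of_real_eq_0_iff) simp
  ultimately show ?thesis
    unfolding is_optimal_fidelity_def
    using kept_fidelity_success_kraus(2)[OF a2 assms(3) \<rho>] by blast
qed

end
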